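(* Let $G$ be a subgroup of $PL_o(I)$, and let $n$ be a natural number. Then $G$ has derived length $n$ (i.e. $G$ is solvable of derived length exactly $n$) if and only if the depth of $G$ is $n$.
   Context: $I=[0,1]$. $PL_o(I)$ is the group, under composition, of orientation-preserving piecewise-linear homeomorphisms of $I$ with finitely many breaks in slope. Elements act on the right ($xg$ is the image of $x$ under $g$). An orbital of a subgroup $G\le PL_o(I)$ is the convex hull of the orbit of a point of $I$ under $G$, provided this set has more than one element; orbitals are open intervals. (Equivalently, orbitals are the connected components of the support of the action of $G$.) An orbital of an element $g$ is an orbital of $\langle g\rangle$. A signed orbital of $G$ is a pair $(A,g)$ with $g\in G$ and $A$ an orbital of $g$; $A$ is its orbital and $g$ its signature. The left total order on $PL_o(I)$: for two distinct elements there is a maximal $x\in[0,1)$ such that they agree on $[0,x]$; the one with the larger right-hand derivative at $x$ is declared the larger. Signed orbitals are partially ordered lexicographically: $(A,g)\le (B,h)$ iff $A\subsetneq B$, or $A=B$ and $g\le h$ in the left total order. A tower of $G$ is a set $T$ of signed orbitals of $G$ such that (1) $T$ is a chain in this partial order, and (2) for each $A$ occurring as the orbital of some element of $T$, $T$ has exactly one element of the form $(A,g)$. The height of a tower is its cardinality. The depth of $G$ is the supremum of the cardinalities of the towers of $G$. *)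

theory Defs
  imports
    "HOL-Analysis.Analysis"
    "HOL-Algebra.Solvable_Groups"
    "HOL-Library.Extended_Nat"
begin

text \<open>
  A homeomorphism of the unit interval is represented by the total function on the reals that
  agrees with it on the interval and is the identity outside, so that equality in the group is
  equality of functions.
\<close>

text \<open>
  The set \<open>P\<close> contains the breaks: \<open>f\<close> is affine on every open subinterval avoiding \<open>P\<close>.
  Values at the points of \<open>P\<close> are determined by the continuity required in \<open>PL_maps\<close>.
\<close>

definition finitely_many_breaks :: "(real \<Rightarrow> real) \<Rightarrow> bool" where
  "finitely_many_breaks f \<longleftrightarrow>
     (\<exists>P. finite P \<and> P \<subseteq> {0..1} \<and>
        (\<forall>a b. a < b \<longrightarrow> {a<..<b} \<subseteq> {0..1} - P \<longrightarrow>
           (\<exists>m c. \<forall>x\<in>{a<..<b}. f x = m * x + c)))"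

definition PL_maps :: "(real \<Rightarrow> real) set" where
  "PL_maps = {f. (\<exists>g. homeomorphism {0..1} {0..1} f g) \<and> strict_mono_on {0..1} f \<and>
                 finitely_many_breaks f \<and> (\<forall>x. x \<notin> {0..1} \<longrightarrow> f x = x)}"

text \<open>Right actions: the product of \<open>f\<close> and \<open>g\<close> applies \<open>f\<close> first.\<close>

definition PLo :: "(real \<Rightarrow> real) monoid" where
  "PLo = \<lparr>carrier = PL_maps, mult = (\<lambda>f g. g \<circ> f), one = id\<rparr>"

definition orbital :: "(real \<Rightarrow> real) set \<Rightarrow> real set \<Rightarrow> bool" where
  "orbital G A \<longleftrightarrow>
     (\<exists>x\<in>{0..1}. A = convex hull ((\<lambda>g. g x) ` G)) \<and> (\<exists>u\<in>A. \<exists>v\<in>A. u \<noteq> v)"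

definition element_orbital :: "(real \<Rightarrow> real) \<Rightarrow> real set \<Rightarrow> bool" where
  "element_orbital g A \<longleftrightarrow> orbital (generate PLo {g}) A"

definition signed_orbitals :: "(real \<Rightarrow> real) set \<Rightarrow> (real set \<times> (real \<Rightarrow> real)) set" where
  "signed_orbitals G = {(A, g). g \<in> G \<and> element_orbital g A}"

definition agree_upto :: "(real \<Rightarrow> real) \<Rightarrow> (real \<Rightarrow> real) \<Rightarrow> real \<Rightarrow> bool" where
  "agree_upto f g x \<longleftrightarrow> (\<forall>y\<in>{0..x}. f y = g y)"

text \<open>The order on elements: \<open>x\<close> is the largest point with agreement on all of \<open>[0, x]\<close>.\<close>

definition left_less :: "(real \<Rightarrow> real) \<Rightarrow> (real \<Rightarrow> real) \<Rightarrow> bool" where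
  "left_less f g \<longleftrightarrow>
     (\<exists>x\<in>{0..<1}. agree_upto f g x \<and> (\<forall>y\<in>{0..<1}. agree_upto f g y \<longrightarrow> y \<le> x) \<and>
        (\<exists>a b. (f has_real_derivative a) (at_right x) \<and>
               (g has_real_derivative b) (at_right x) \<and> a < b))"

definition left_le :: "(real \<Rightarrow> real) \<Rightarrow> (real \<Rightarrow> real) \<Rightarrow> bool" where
  "left_le f g \<longleftrightarrow> f = g \<or> left_less f g"

definition signed_le ::
  "real set \<times> (real \<Rightarrow> real) \<Rightarrow> real set \<times> (real \<Rightarrow> real) \<Rightarrow> bool" where
  "signed_le S T \<longleftrightarrow> fst S \<subset> fst T \<or> (fst S = fst T \<and> left_le (snd S) (snd T))"

definition tower :: "(real \<Rightarrow> real) set \<Rightarrow> (real set \<times> (real \<Rightarrow> real)) set \<Rightarrow> bool" where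
  "tower G T \<longleftrightarrow>
     T \<subseteq> signed_orbitals G \<and>
     Complete_Partial_Order.chain signed_le T \<and>
     (\<forall>A\<in>fst ` T. \<exists>!g. (A, g) \<in> T)"

text \<open>Infinite cardinalities are not distinguished from one another.\<close>

definition height :: "'a set \<Rightarrow> enat" where
  "height T = (if finite T then enat (card T) else \<infinity>)"

definition depth :: "(real \<Rightarrow> real) set \<Rightarrow> enat" where
  "depth G = (SUP T\<in>{T. tower G T}. height T)"

text \<open>Only meaningful for solvable groups; otherwise the least number is unspecified.\<close>

definition derived_length :: "('a, 'b) monoid_scheme \<Rightarrow> nat" where
  "derived_length G = (LEAST n. (derived G ^^ n) (carrier G) = {\<one>\<^bsub>G\<^esub>})"

lemma PL_maps_comp:
  assumes f: "f \<in> PL_maps" and h: "h \<in> PL_maps"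
  shows "h \<circ> f \<in> PL_maps"
proof -
  obtain g where g: "homeomorphism {0..1} {0..1} f g" using f by (auto simp: PL_maps_def)
  obtain k where k: "homeomorphism {0..1} {0..1} h k" using h by (auto simp: PL_maps_def)
  have hom: "homeomorphism {0..1} {0..1} (h \<circ> f) (g \<circ> k)"
    by (rule homeomorphism_compose[OF g k])
  have f01: "f ` {0..1} = {0..1}" and g01: "g ` {0..1} = {0..1}"
    and gf: "\<And>x. x \<in> {0..1} \<Longrightarrow> g (f x) = x" and fg: "\<And>x. x \<in> {0..1} \<Longrightarrow> f (g x) = x"
    using g by (auto simp: homeomorphism_def)
  have smf: "strict_mono_on {0..1} f" and smh: "strict_mono_on {0..1} h"
    using f h by (auto simp: PL_maps_def)
  have sm: "strict_mono_on {0..1} (h \<circ> f)"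
  proof (rule strict_mono_onI)
    fix r s :: real assume rs: "r \<in> {0..1}" "s \<in> {0..1}" "r < s"
    then have "f r \<in> {0..1}" "f s \<in> {0..1}" using f01 by blast+
    then show "(h \<circ> f) r < (h \<circ> f) s"
      using strict_mono_onD[OF smf rs] strict_mono_onD[OF smh, of "f r" "f s"] by simp
  qed
  have idf: "\<And>x. x \<notin> {0..1} \<Longrightarrow> f x = x" and idh: "\<And>x. x \<notin> {0..1} \<Longrightarrow> h x = x"
    using f h by (auto simp: PL_maps_def)
  obtain P where P: "finite P" "P \<subseteq> {0..1}"
    "\<And>a b. a < b \<Longrightarrow> {a<..<b} \<subseteq> {0..1} - P \<Longrightarrow> \<exists>m c. \<forall>x\<in>{a<..<b}. f x = m * x + c"
    using f by (unfold PL_maps_def finitely_many_breaks_def, blast)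
  obtain Q where Q: "finite Q" "Q \<subseteq> {0..1}"
    "\<And>a b. a < b \<Longrightarrow> {a<..<b} \<subseteq> {0..1} - Q \<Longrightarrow> \<exists>m c. \<forall>x\<in>{a<..<b}. h x = m * x + c"
    using h by (unfold PL_maps_def finitely_many_breaks_def, blast)
  have "finitely_many_breaks (h \<circ> f)"
    unfolding finitely_many_breaks_def
  proof (intro exI[of _ "P \<union> g ` Q"] conjI allI impI)
    show "finite (P \<union> g ` Q)" using P Q by auto
    show "P \<union> g ` Q \<subseteq> {0..1}" using P Q g01 by blast
    fix a b :: real assume ab: "a < b" and sub: "{a<..<b} \<subseteq> {0..1} - (P \<union> g ` Q)"
    have "{a<..<b} \<subseteq> {0..1}" using sub by blast
    then have ab01: "0 \<le> a" "b \<le> 1" using ab by (auto simp: greaterThanLessThan_subseteq_atLeastAtMost_iff)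
    obtain m c where mc: "\<forall>x\<in>{a<..<b}. f x = m * x + c" using P(3)[OF ab] sub by blast
    have lt: "f a < f b" using strict_mono_onD[OF smf, of a b] ab ab01 by auto
    have ins: "g y \<in> {a<..<b} \<and> y \<in> {0..1} - Q" if "y \<in> {f a<..<f b}" for y
    proof -
      have "a \<in> {0..1}" "b \<in> {0..1}" using ab ab01 by auto
      then have "f a \<in> {0..1}" "f b \<in> {0..1}" using f01 by blast+
      then have y01: "y \<in> {0..1}" using that by auto
      then have gy: "g y \<in> {0..1}" "f (g y) = y" using g01 fg by blast+
      have "a < g y" "g y < b"
        using strict_mono_on_less[OF smf, of a "g y"] strict_mono_on_less[OF smf, of "g y" b]
          gy that ab ab01 by auto
      then show ?thesis using sub y01 by auto
    qed
    obtain m' c' where mc': "\<forall>y\<in>{f a<..<f b}. h y = m' * y + c'" using Q(3)[OF lt] ins by blast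
    show "\<exists>m c. \<forall>x\<in>{a<..<b}. (h \<circ> f) x = m * x + c"
    proof (intro exI ballI)
      fix x assume x: "x \<in> {a<..<b}"
      then have "f x \<in> {f a<..<f b}"
        using strict_mono_onD[OF smf, of a x] strict_mono_onD[OF smf, of x b] ab01 by auto
      then have "h (f x) = m' * (m * x + c) + c'" using mc mc' x by auto
      then show "(h \<circ> f) x = (m' * m) * x + (m' * c + c')" by (simp add: algebra_simps)
    qed
  qed
  then show ?thesis using hom sm idf idh by (simp add: PL_maps_def) blast
qed

lemma PL_maps_inverse:
  assumes f: "f \<in> PL_maps"
  shows "\<exists>g\<in>PL_maps. f \<circ> g = id \<and> g \<circ> f = id"
proof -
  obtain g0 where g0: "homeomorphism {0..1} {0..1} f g0" using f by (auto simp: PL_maps_def)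
  define g where "g x = (if x \<in> {0..1} then g0 x else x)" for x
  have g: "homeomorphism {0..1} {0..1} f g"
    by (rule homeomorphism_cong[OF g0]) (auto simp: g_def)
  have f01: "f ` {0..1} = {0..1}" and g01: "g ` {0..1} = {0..1}"
    and gf: "\<And>x. x \<in> {0..1} \<Longrightarrow> g (f x) = x" and fg: "\<And>x. x \<in> {0..1} \<Longrightarrow> f (g x) = x"
    using g by (auto simp: homeomorphism_def)
  have idf: "\<And>x. x \<notin> {0..1} \<Longrightarrow> f x = x" using f by (auto simp: PL_maps_def)
  have idg: "\<And>x. x \<notin> {0..1} \<Longrightarrow> g x = x" by (auto simp: g_def)
  have smf: "strict_mono_on {0..1} f" using f by (auto simp: PL_maps_def)
  have smg: "strict_mono_on {0..1} g"
  proof (rule strict_mono_onI)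
    fix r s :: real assume rs: "r \<in> {0..1}" "s \<in> {0..1}" "r < s"
    then have "g r \<in> {0..1}" "g s \<in> {0..1}" using g01 by blast+
    then show "g r < g s" using strict_mono_on_less[OF smf, of "g r" "g s"] fg rs by simp
  qed
  obtain P where P: "finite P" "P \<subseteq> {0..1}"
    "\<And>a b. a < b \<Longrightarrow> {a<..<b} \<subseteq> {0..1} - P \<Longrightarrow> \<exists>m c. \<forall>x\<in>{a<..<b}. f x = m * x + c"
    using f by (unfold PL_maps_def finitely_many_breaks_def, blast)
  have "finitely_many_breaks g"
    unfolding finitely_many_breaks_def
  proof (intro exI[of _ "f ` P"] conjI allI impI)
    show "finite (f ` P)" using P by auto
    show "f ` P \<subseteq> {0..1}" using P f01 by blast
    fix a b :: real assume ab: "a < b" and sub: "{a<..<b} \<subseteq> {0..1} - f ` P"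
    have "{a<..<b} \<subseteq> {0..1}" using sub by blast
    then have ab01: "0 \<le> a" "b \<le> 1" using ab by (auto simp: greaterThanLessThan_subseteq_atLeastAtMost_iff)
    have lt: "g a < g b" using strict_mono_onD[OF smg, of a b] ab ab01 by auto
    have ins: "x \<in> {0..1} - P" if "x \<in> {g a<..<g b}" for x
    proof -
      have "a \<in> {0..1}" "b \<in> {0..1}" using ab ab01 by auto
      then have gab: "g a \<in> {0..1}" "g b \<in> {0..1}" using g01 by blast+
      then have x01: "x \<in> {0..1}" using that by auto
      have "f (g a) < f x" "f x < f (g b)"
        using strict_mono_onD[OF smf gab(1) x01] strict_mono_onD[OF smf x01 gab(2)] that by auto
      then have "f x \<in> {a<..<b}" using fg ab ab01 by auto
      then show ?thesis using sub x01 by blast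
    qed
    obtain m c where mc: "\<forall>x\<in>{g a<..<g b}. f x = m * x + c" using P(3)[OF lt] ins by blast
    have eq: "y = m * g y + c" if y: "y \<in> {a<..<b}" for y
    proof -
      have "g a < g y" "g y < g b"
        using strict_mono_onD[OF smg, of a y] strict_mono_onD[OF smg, of y b] y ab01 by auto
      then have "f (g y) = m * g y + c" using mc by auto
      then show ?thesis using fg[of y] y ab01 by auto
    qed
    have "m \<noteq> 0"
    proof
      assume "m = 0"
      then have "\<And>y. y \<in> {a<..<b} \<Longrightarrow> y = c" using eq by fastforce
      moreover have "(a + b) / 2 \<in> {a<..<b}" "(2 * a + b) / 3 \<in> {a<..<b}"
        using ab by (auto simp: field_simps)
      ultimately have "(a + b) / 2 = (2 * a + b) / 3" by metis
      then show False using ab by (auto simp: field_simps)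
    qed
    have "\<forall>y\<in>{a<..<b}. g y = (1 / m) * y + (- c / m)"
    proof
      fix y assume "y \<in> {a<..<b}"
      then show "g y = (1 / m) * y + (- c / m)"
        using eq[of y] \<open>m \<noteq> 0\<close> by (simp add: divide_simps) argo
    qed
    then show "\<exists>m c. \<forall>y\<in>{a<..<b}. g y = m * y + c" by blast
  qed
  moreover have "homeomorphism {0..1} {0..1} g f"
    using g by (rule homeomorphism_symD)
  ultimately have g_in: "g \<in> PL_maps"
    using smg idg unfolding PL_maps_def by blast
  have "f (g x) = x" for x
  proof (cases "x \<in> {0..1}")
    case True
    then show ?thesis by (rule fg)
  next
    case False
    then show ?thesis by (simp only: idg idf not_False_eq_True)
  qed
  then have fg_id: "f \<circ> g = id" by (simp add: fun_eq_iff)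
  have "g (f x) = x" for x
  proof (cases "x \<in> {0..1}")
    case True
    then show ?thesis by (rule gf)
  next
    case False
    then show ?thesis by (simp only: idg idf not_False_eq_True)
  qed
  then have "g \<circ> f = id" by (simp add: fun_eq_iff)
  with g_in fg_id show ?thesis by blast
qed

lemma group_PLo: "group PLo"
proof (rule groupI)
  show "\<one>\<^bsub>PLo\<^esub> \<in> carrier PLo"
  proof -
    have "homeomorphism {0..1} {0..1} id (id :: real \<Rightarrow> real)" by (simp add: homeomorphism_def)
    moreover have "finitely_many_breaks id"
      unfolding finitely_many_breaks_def
    proof (intro exI[of _ "{}"] conjI allI impI)
      fix a b :: real
      have "\<forall>x\<in>{a<..<b}. id x = 1 * x + 0" by simp
      then show "\<exists>m c. \<forall>x\<in>{a<..<b}. id x = m * x + c" by blast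
    qed simp_all
    ultimately show ?thesis by (auto simp: PLo_def PL_maps_def strict_mono_on_def)
  qed
  show "\<exists>g\<in>carrier PLo. g \<otimes>\<^bsub>PLo\<^esub> f = \<one>\<^bsub>PLo\<^esub>" if "f \<in> carrier PLo" for f
    using PL_maps_inverse[of f] that by (auto simp: PLo_def)
qed (simp_all add: PLo_def PL_maps_comp o_assoc)

end

theory Submission
  imports Defs
begin

text \<open>
  Call two distinct element orbitals crossing if they overlap and neither contains the closure of
  the other. If \<open>g\<close> and \<open>h\<close> have crossing orbitals, the derived subgroup \<open>K\<close> of the group
  generated by \<open>g\<close> and \<open>h\<close> preserves an interval \<open>(p, q)\<close> without a common fixed point in it, while
  all its elements are trivial near \<open>p\<close> and \<open>q\<close>, because PL germs at a fixed point commute.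
  Such a \<open>K\<close> is not solvable: if its derived subgroup fixed a point of \<open>(p, q)\<close>, then it would fix
  points of the same \<open>K\<close>-orbit arbitrarily close to \<open>p\<close>, which any given element of \<open>K\<close> fixes, and
  by commutation \<open>K\<close> would fix the point we started from. It also has towers of any height, as some
  element of \<open>K\<close> moves any given point of \<open>(p, q)\<close> beyond any other one.

  Without crossing orbitals, nested orbitals are nested with their closures. Then passing from \<open>G\<close> to
  its derived subgroup lowers the maximal tower height by exactly one: an orbital strictly
  below another one is an orbital of a commutator, and an orbital of an element of the derived
  subgroup is strictly contained in another orbital of \<open>G\<close>. Hence the \<open>n\<close>-th derived
  subgroup is trivial iff there is no tower of height \<open>n + 1\<close>.
\<close>

section \<open>Dynamics of increasing bijections of the line\<close>

text \<open>PL maps extended by the identity are such maps of the whole line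
  (\<open>PL_map_order_bij\<close>), which spares case distinctions at 0 and 1.\<close>

definition order_bij :: "(real \<Rightarrow> real) \<Rightarrow> bool" where
  "order_bij g \<longleftrightarrow> strict_mono g \<and> surj g"

text \<open>An orbital given by its ends. Generators suffice to recognise it: a set of PL maps has
  the same components as the group it generates.\<close>

definition component :: "(real \<Rightarrow> real) set \<Rightarrow> real \<Rightarrow> real \<Rightarrow> bool" where
  "component K p q \<longleftrightarrow>
     p < q \<and> (\<forall>k\<in>K. k p = p \<and> k q = q) \<and> (\<forall>x\<in>{p<..<q}. \<exists>k\<in>K. k x \<noteq> x)"

text \<open>Conjugation with x -> -x; it exchanges left and right, so only one of two mirror
  statements has to be proved directly.\<close>

definition reflect :: "(real \<Rightarrow> real) \<Rightarrow> real \<Rightarrow> real" where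
  "reflect g x = - g (- x)"

lemma order_bij_less: "order_bij g \<Longrightarrow> g x < g y \<longleftrightarrow> x < y"
  by (simp add: order_bij_def strict_mono_less)

lemma order_bij_le: "order_bij g \<Longrightarrow> g x \<le> g y \<longleftrightarrow> x \<le> y"
  by (simp add: order_bij_def strict_mono_less_eq)

lemma order_bij_eq: "order_bij g \<Longrightarrow> g x = g y \<longleftrightarrow> x = y"
  by (simp add: order_bij_def strict_mono_eq)

lemma order_bij_reflect:
  assumes "order_bij g"
  shows "order_bij (reflect g)"
  unfolding order_bij_def
proof
  show "strict_mono (reflect g)"
    using order_bij_less[OF assms] by (auto simp: reflect_def strict_mono_def)
  show "surj (reflect g)"
  proof (rule surjI)
    fix y
    have "g (inv_into UNIV g (- y)) = - y"
      using assms by (simp add: order_bij_def surj_f_inv_f)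
    then show "reflect g (- inv_into UNIV g (- y)) = y"
      by (simp add: reflect_def)
  qed
qed

lemma component_reflect:
  assumes "component K p q"
  shows "component (reflect ` K) (- q) (- p)"
proof -
  have "\<exists>k\<in>K. reflect k x \<noteq> x" if x: "x \<in> {- q<..<- p}" for x
  proof -
    obtain k where "k \<in> K" "k (- x) \<noteq> - x"
      using assms x unfolding component_def by (metis greaterThanLessThan_iff minus_less_iff less_minus_iff)
    then show ?thesis by (auto simp: reflect_def intro!: bexI[of _ k])
  qed
  then show ?thesis using assms by (auto simp: component_def reflect_def)
qed

text \<open>An increasing bijection carries the least upper bound of \<open>S\<close> to that of the
  image of \<open>S\<close>, which is \<open>S\<close> again.\<close>

lemma Sup_fixed:
  assumes g: "order_bij g" and S: "g ` S = S" "S \<noteq> {}" "bdd_above S"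
  shows "g (Sup S) = Sup S"
proof (rule antisym)
  obtain z where z: "Sup S = g z"
    using g unfolding order_bij_def by (metis surj_def)
  have "z \<ge> Sup S"
  proof (rule cSup_least[OF S(2)])
    fix s assume "s \<in> S"
    then have "g s \<le> g z"
      using S z by (metis cSup_upper imageI)
    then show "s \<le> z" by (simp add: order_bij_le[OF g])
  qed
  then show "g (Sup S) \<le> Sup S"
    using z by (metis order_bij_le[OF g])
  show "Sup S \<le> g (Sup S)"
  proof (rule cSup_least[OF S(2)])
    fix s assume "s \<in> S"
    then obtain t where "t \<in> S" "s = g t" using S(1) by blast
    then show "s \<le> g (Sup S)"
      using S by (simp add: order_bij_le[OF g] cSup_upper)
  qed
qed

lemma Inf_fixed:
  assumes g: "order_bij g" and S: "g ` S = S" "S \<noteq> {}" "bdd_below S"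
  shows "g (Inf S) = Inf S"
proof -
  have "reflect g ` (uminus ` S) = uminus ` g ` S"
    by (auto simp: reflect_def image_image)
  then have "reflect g (Sup (uminus ` S)) = Sup (uminus ` S)"
    using S by (intro Sup_fixed order_bij_reflect[OF g]) auto
  then show ?thesis by (simp add: Inf_real_def reflect_def)
qed

text \<open>Supremum and infimum of \<open>S\<close> are common fixed points of \<open>K\<close> in
  [p, q]. As \<open>K\<close> has none strictly inside, they are \<open>q\<close> and
  \<open>p\<close>.\<close>

lemma component_invariant_unbounded:
  assumes K: "\<And>k. k \<in> K \<Longrightarrow> order_bij k" and c: "component K p q"
    and S: "S \<subseteq> {p<..<q}" "S \<noteq> {}" and inv: "\<And>k. k \<in> K \<Longrightarrow> k ` S = S"
  shows "p < y \<Longrightarrow> \<exists>s\<in>S. s < y" "y < q \<Longrightarrow> \<exists>s\<in>S. y < s"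
proof -
  have bd: "bdd_above S" "bdd_below S"
    using bdd_above_mono[OF _ S(1)] bdd_below_mono[OF _ S(1)] by auto
  obtain s where s: "s \<in> S" "p < s" "s < q" using S by fastforce
  have "s \<le> Sup S" "Inf S \<le> s" using bd s by (auto intro: cSup_upper cInf_lower)
  moreover have "Sup S \<le> q" "p \<le> Inf S"
    using S by (force intro!: cSup_least cInf_greatest)+
  moreover have "Sup S \<notin> {p<..<q}" "Inf S \<notin> {p<..<q}"
    using Sup_fixed[OF K inv S(2) bd(1)] Inf_fixed[OF K inv S(2) bd(2)] c
    unfolding component_def by blast+
  ultimately have "Sup S = q" "Inf S = p" using s by auto
  then show "p < y \<Longrightarrow> \<exists>s\<in>S. s < y" "y < q \<Longrightarrow> \<exists>s\<in>S. y < s"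
    using less_cSup_iff[OF S(2) bd(1)] cInf_less_iff[OF S(2) bd(2)] by auto
qed

lemma image_Collect_invariant:
  assumes "g ` F = F" and "\<And>z. z \<in> F \<Longrightarrow> P (g z) \<longleftrightarrow> P z"
  shows "g ` {z \<in> F. P z} = {z \<in> F. P z}"
proof (intro equalityI subsetI)
  fix y assume "y \<in> g ` {z \<in> F. P z}"
  then show "y \<in> {z \<in> F. P z}" using assms by auto
next
  fix y assume y: "y \<in> {z \<in> F. P z}"
  then obtain z where "z \<in> F" "y = g z" using assms(1) by blast
  then show "y \<in> g ` {z \<in> F. P z}" using y assms(2) by auto
qed

lemma image_eq_if_fixed: "(\<And>s. s \<in> S \<Longrightarrow> k s = s) \<Longrightarrow> k ` S = S"
  by simp

text \<open>The ends are the nearest common fixed points on the two sides of \<open>x\<close>. The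
  candidates include 0 and 1, and their supremum and infimum are again fixed by all of
  \<open>K\<close>.\<close>

lemma component_exists:
  assumes K: "\<And>k. k \<in> K \<Longrightarrow> order_bij k"
    and fxd: "\<And>k x. k \<in> K \<Longrightarrow> x \<le> 0 \<or> 1 \<le> x \<Longrightarrow> k x = x"
    and k: "k \<in> K" "k x \<noteq> x"
  obtains p q where "component K p q" "p < x" "x < q"
proof -
  define A where "A = {y. y \<le> x \<and> (\<forall>k\<in>K. k y = y)}"
  define B where "B = {y. x \<le> y \<and> (\<forall>k\<in>K. k y = y)}"
  have x: "0 < x" "x < 1" using fxd[OF k(1), of x] k(2) by linarith+
  have A: "0 \<in> A" "bdd_above A" and B: "1 \<in> B" "bdd_below B"
    using x fxd unfolding A_def B_def by (auto intro!: bdd_aboveI[of _ x] bdd_belowI[of _ x])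
  have fxdA: "k (Sup A) = Sup A" if "k \<in> K" for k
    using A that by (intro Sup_fixed K image_eq_if_fixed) (auto simp: A_def)
  have fxdB: "k (Inf B) = Inf B" if "k \<in> K" for k
    using B that by (intro Inf_fixed K image_eq_if_fixed) (auto simp: B_def)
  have "Sup A \<le> x" using A(1) by (intro cSup_least) (auto simp: A_def)
  moreover have "Sup A \<noteq> x" using fxdA k by auto
  moreover have "x \<le> Inf B" using B(1) by (intro cInf_greatest) (auto simp: B_def)
  moreover have "Inf B \<noteq> x" using fxdB k by auto
  ultimately have less: "Sup A < x" "x < Inf B" by auto
  have "\<exists>k\<in>K. k y \<noteq> y" if "y \<in> {Sup A<..<Inf B}" for y
  proof (rule ccontr)
    assume "\<not> ?thesis"
    then have "y \<in> A \<or> y \<in> B" by (auto simp: A_def B_def)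
    then show False using that A B cSup_upper[of y A] cInf_lower[of y B] by auto
  qed
  then have "component K (Sup A) (Inf B)"
    using fxdA fxdB less by (auto simp: component_def)
  then show ?thesis using that less by blast
qed

lemma component_fixed_outside:
  assumes "component {g} a b" "g y = y"
  shows "y \<le> a \<or> b \<le> y"
  using assms unfolding component_def by fastforce

lemma component_mem_iff:
  assumes "order_bij g" "g a = a" "g b = b"
  shows "a < g x \<and> g x < b \<longleftrightarrow> a < x \<and> x < b"
  using order_bij_less[OF assms(1), of a x] order_bij_less[OF assms(1), of x b] assms by simp

section \<open>Common fixed points in the presence of crossing intervals\<close>

text \<open>In the application \<open>K\<close> is the derived subgroup of the group generated by
  \<open>g\<close> and \<open>h\<close>, so both preserve \<open>F\<close> and commute on it. First
  \<open>F\<close> is shown to miss (a, b), then (c, d). The rest of \<open>F\<close> lies left of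
  \<open>a\<close> or right of \<open>d\<close>; each of these parts is invariant, so if nonempty it
  would have to approach both \<open>p\<close> and \<open>q\<close>.\<close>

lemma crossing_no_common_fixed_left:
  assumes g: "order_bij g" and h: "order_bij h" and K: "\<And>k. k \<in> K \<Longrightarrow> order_bij k"
    and cg: "component {g} a b" and ch: "component {h} c d" and cgh: "component {g, h} p q"
    and ord: "a \<le> c" "c < b" "b < d" and b: "p < b" "b < q"
    and F: "F = {z. p < z \<and> z < q \<and> (\<forall>k\<in>K. k z = z)}"
    and gF: "g ` F = F" and hF: "h ` F = F"
    and comm: "\<And>z. z \<in> F \<Longrightarrow> g (h z) = h (g z)"
  shows "F = {}"
proof -
  have fp: "g p = p" "h p = p" "g q = q" "h q = q" using cgh by (auto simp: component_def)
  have fxd: "g a = a" "g b = b" "h c = c" "h d = d" using cg ch by (auto simp: component_def)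
  have bd: "p \<le> a" "p \<le> c" "d \<le> q"
    using component_fixed_outside[OF cg fp(1)] component_fixed_outside[OF ch fp(2)]
      component_fixed_outside[OF ch fp(4)] ord b by auto
  have ghob: "\<And>k. k \<in> {g, h} \<Longrightarrow> order_bij k" using g h by auto
  have ab: "\<not> (a < z \<and> z < b)" if z: "z \<in> F" for z
  proof
    assume zab: "a < z \<and> z < b"
    define S where "S = {z \<in> F. a < z \<and> z < b}"
    have S: "g ` S = S" "S \<noteq> {}" "S \<subseteq> {a<..<b}"
    proof -
      show "g ` S = S" unfolding S_def
        by (rule image_Collect_invariant[OF gF]) (rule component_mem_iff[OF g fxd(1,2)])
      show "S \<noteq> {}" "S \<subseteq> {a<..<b}" using z zab by (auto simp: S_def)
    qed
    have bdS: "bdd_above S" by (rule bdd_above_mono[OF _ S(3)]) simp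
    have "Sup S \<le> b" using S by (force intro!: cSup_least)
    moreover have "z \<le> Sup S" using z zab bdS by (auto simp: S_def intro!: cSup_upper)
    \<comment> \<open>\<open>g\<close> fixes the supremum, which lies in (a, b].\<close>
    ultimately have "Sup S = b"
      using component_fixed_outside[OF cg Sup_fixed[OF g S(1,2) bdS]] zab by linarith
    moreover have "k (Sup S) = Sup S" if k: "k \<in> K" for k
      using k by (intro Sup_fixed[OF K[OF k] _ S(2) bdS] image_eq_if_fixed) (auto simp: S_def F)
    ultimately have bF: "b \<in> F" using b by (auto simp: F)
    \<comment> \<open>Since \<open>g\<close> and \<open>h\<close> commute on \<open>F\<close>,
      \<open>h\<close> permutes the fixed points of \<open>g\<close> in \<open>F\<close>. Starting
      from \<open>b\<close>, this produces fixed points of \<open>g\<close> between \<open>c\<close>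
      and \<open>b\<close>, hence inside (a, b).\<close>
    define R where "R = {z \<in> F. g z = z \<and> c < z \<and> z < d}"
    have hR: "h ` R = R" unfolding R_def
      by (rule image_Collect_invariant[OF hF])
        (metis comm order_bij_eq[OF h] component_mem_iff[OF h fxd(3,4)])
    have "b \<in> R" using bF fxd ord by (auto simp: R_def)
    then have R: "R \<subseteq> {c<..<d}" "R \<noteq> {}" by (auto simp: R_def)
    obtain s where "s \<in> R" "s < b"
      using component_invariant_unbounded(1)[OF _ ch R, of b] h hR ord(2) by auto
    then show False
      using component_fixed_outside[OF cg, of s] ord by (auto simp: R_def)
  qed
  have cd: "\<not> (c < z \<and> z < d)" if z: "z \<in> F" for z
  proof
    assume zcd: "c < z \<and> z < d"
    define S where "S = {z \<in> F. c < z \<and> z < d}"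
    have S: "h ` S = S" "S \<noteq> {}" "S \<subseteq> {c<..<d}"
    proof -
      show "h ` S = S" unfolding S_def
        by (rule image_Collect_invariant[OF hF]) (rule component_mem_iff[OF h fxd(3,4)])
      show "S \<noteq> {}" "S \<subseteq> {c<..<d}" using z zcd by (auto simp: S_def)
    qed
    obtain s where "s \<in> S" "s < b"
      using component_invariant_unbounded(1)[OF _ ch S(3,2), of b] h S(1) ord(2) by auto
    then show False using ab[of s] ord by (auto simp: S_def)
  qed
  have ad: "z \<le> a \<or> d \<le> z" if "z \<in> F" for z
    using ab[OF that] cd[OF that] ord by linarith
  show "F = {}"
  proof (rule ccontr)
    assume "F \<noteq> {}"
    then obtain z where z: "z \<in> F" by blast
    have FS: "F \<subseteq> {p<..<q}" by (auto simp: F)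
    have mem: "g z \<in> F" "h z \<in> F" if "z \<in> F" for z using gF hF that by auto
    have gle: "g z \<le> a \<longleftrightarrow> z \<le> a" for z using order_bij_le[OF g, of z a] fxd by simp
    \<comment> \<open>\<open>h\<close> may move \<open>a\<close>, but it preserves both sides of
      \<open>c\<close> and of \<open>d\<close>, and \<open>F\<close> has no point strictly between
      \<open>a\<close> and \<open>d\<close>.\<close>
    have hle: "h z \<le> a \<longleftrightarrow> z \<le> a" if "z \<in> F" for z
      using order_bij_le[OF h, of z c] order_bij_le[OF h, of d z] fxd ad[OF that]
        ad[OF mem(2)[OF that]] ord by auto
    have inv: "k ` {z \<in> F. z \<le> a} = {z \<in> F. z \<le> a}"
      "k ` {z \<in> F. \<not> z \<le> a} = {z \<in> F. \<not> z \<le> a}" if "k \<in> {g, h}" for k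
    proof -
      have "k ` F = F" "\<And>z. z \<in> F \<Longrightarrow> k z \<le> a \<longleftrightarrow> z \<le> a"
        using that gF hF gle hle by blast+
      then show "k ` {z \<in> F. z \<le> a} = {z \<in> F. z \<le> a}"
        "k ` {z \<in> F. \<not> z \<le> a} = {z \<in> F. \<not> z \<le> a}"
        by (auto intro!: image_Collect_invariant simp del: not_le)
    qed
    show False
    proof (cases "z \<le> a")
      case True
      have "\<exists>s\<in>{z \<in> F. z \<le> a}. b < s"
        by (rule component_invariant_unbounded(2)[OF ghob cgh _ _ inv(1) b(2)])
          (use FS z True in auto)
      then show False using ord by auto
    next
      case False
      have "\<exists>s\<in>{z \<in> F. \<not> z \<le> a}. s < b"
        by (rule component_invariant_unbounded(1)[OF ghob cgh _ _ inv(2) b(1)])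
          (use FS z False in auto)
      then show False using ad ord by force
    qed
  qed
qed

text \<open>The mirror image of \<open>crossing_no_common_fixed_left\<close>, with -b, -d, -a, -c in
  the roles of a, c, b, d.\<close>

lemma crossing_no_common_fixed_right:
  assumes g: "order_bij g" and h: "order_bij h" and K: "\<And>k. k \<in> K \<Longrightarrow> order_bij k"
    and cg: "component {g} a b" and ch: "component {h} c d" and cgh: "component {g, h} p q"
    and ord: "c < a" "a < d" "d \<le> b" and a: "p < a" "a < q"
    and F: "F = {z. p < z \<and> z < q \<and> (\<forall>k\<in>K. k z = z)}"
    and gF: "g ` F = F" and hF: "h ` F = F"
    and comm: "\<And>z. z \<in> F \<Longrightarrow> g (h z) = h (g z)"
  shows "F = {}"
proof -
  have img: "reflect k ` (uminus ` F) = uminus ` F" if "k ` F = F" for k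
  proof -
    have "reflect k ` (uminus ` F) = uminus ` k ` F"
      by (auto simp: reflect_def image_image)
    then show ?thesis using that by simp
  qed
  have "uminus ` F = {}"
  proof (rule crossing_no_common_fixed_left)
    show "order_bij (reflect g)" "order_bij (reflect h)" using g h by (auto intro: order_bij_reflect)
    show "\<And>k. k \<in> reflect ` K \<Longrightarrow> order_bij k" using K by (auto intro: order_bij_reflect)
    show "component {reflect g} (- b) (- a)" using component_reflect[OF cg] by simp
    show "component {reflect h} (- d) (- c)" using component_reflect[OF ch] by simp
    show "component {reflect g, reflect h} (- q) (- p)" using component_reflect[OF cgh] by simp
    show "uminus ` F = {z. - q < z \<and> z < - p \<and> (\<forall>k\<in>reflect ` K. k z = z)}"
    proof (intro equalityI subsetI)
      fix z assume "z \<in> {z. - q < z \<and> z < - p \<and> (\<forall>k\<in>reflect ` K. k z = z)}"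
      then have "- z \<in> F" by (auto simp: F reflect_def)
      then show "z \<in> uminus ` F" by (metis add.inverse_inverse imageI)
    qed (auto simp: F reflect_def)
    show "\<And>z. z \<in> uminus ` F \<Longrightarrow> reflect g (reflect h z) = reflect h (reflect g z)"
      using comm by (auto simp: reflect_def)
    show "reflect g ` (uminus ` F) = uminus ` F" "reflect h ` (uminus ` F) = uminus ` F"
      using img[OF gF] img[OF hF] by blast+
  qed (use ord a in auto)
  then show ?thesis by simp
qed

section \<open>Subgroups of the PL group\<close>

interpretation PLo: group PLo
  by (rule group_PLo)

lemma PL_map_0_1:
  assumes "f \<in> PL_maps"
  shows "f 0 = 0" "f 1 = 1"
proof -
  obtain g where "homeomorphism {0..1} {0..1} f g" using assms by (auto simp: PL_maps_def)
  then have im: "f ` {0..1} = {0..1}" by (auto simp: homeomorphism_def)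
  have sm: "strict_mono_on {0..1} f" using assms by (auto simp: PL_maps_def)
  have "0 \<in> f ` {0..1}" "1 \<in> f ` {0..1}" by (simp_all add: im)
  then obtain u v where u: "u \<in> {0..1}" "f u = 0" and v: "v \<in> {0..1}" "f v = 1"
    by (metis imageE)
  have "f 0 \<in> f ` {0..1}" "f 1 \<in> f ` {0..1}" by simp_all
  then have "f 0 \<in> {0..1}" "f 1 \<in> {0..1}" unfolding im by blast+
  moreover have "f 0 \<le> f u" "f v \<le> f 1"
    using u v strict_mono_on_leD[OF sm, of 0 u] strict_mono_on_leD[OF sm, of v 1] by auto
  ultimately show "f 0 = 0" "f 1 = 1" using u v by auto
qed

lemma PL_map_fixed_outside:
  assumes "f \<in> PL_maps" "x \<le> 0 \<or> 1 \<le> x"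
  shows "f x = x"
proof (cases "x = 0 \<or> x = 1")
  case True
  then show ?thesis using PL_map_0_1[OF assms(1)] by blast
next
  case False
  then have "x \<notin> {0..1}" using assms(2) by auto
  then show ?thesis using assms(1) unfolding PL_maps_def by blast
qed

lemma PL_map_order_bij:
  assumes f: "f \<in> PL_maps"
  shows "order_bij f"
  unfolding order_bij_def
proof
  obtain g where "homeomorphism {0..1} {0..1} f g" using f by (auto simp: PL_maps_def)
  then have im: "f ` {0..1} = {0..1}" by (auto simp: homeomorphism_def)
  have sm: "strict_mono_on {0..1} f" using f by (auto simp: PL_maps_def)
  have out: "f x = x" if "x \<le> 0 \<or> 1 \<le> x" for x using PL_map_fixed_outside[OF f that] .
  have inside: "0 < f x \<and> f x < 1" if "0 < x" "x < 1" for x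
    using strict_mono_onD[OF sm, of 0 x] strict_mono_onD[OF sm, of x 1] PL_map_0_1[OF f] that
    by auto
  show "strict_mono f"
  proof (rule strict_monoI)
    fix x y :: real assume "x < y"
    consider "x \<le> 0" | "1 \<le> y" | "0 < x" "y < 1" by linarith
    then show "f x < f y"
    proof cases
      case 1
      then show ?thesis using out[of x] out[of y] inside[of y] \<open>x < y\<close> by (cases "0 < y \<and> y < 1") auto
    next
      case 2
      then show ?thesis using out[of x] out[of y] inside[of x] \<open>x < y\<close> by (cases "0 < x \<and> x < 1") auto
    next
      case 3
      then show ?thesis using strict_mono_onD[OF sm, of x y] \<open>x < y\<close> by auto
    qed
  qed
  show "surj f"
  proof -
    have "\<exists>x. y = f x" for y
    proof (cases "y \<in> {0..1}")
      case True
      then show ?thesis using im by blast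
    next
      case False
      then show ?thesis using out[of y] by (intro exI[of _ y]) auto
    qed
    then show ?thesis by (auto simp: surj_def)
  qed
qed

lemma order_bij_continuous:
  assumes "order_bij f"
  shows "continuous_on UNIV f"
proof (rule continuous_onI_mono)
  show "open (f ` UNIV)" using assms by (simp add: order_bij_def)
qed (simp add: order_bij_le[OF assms])

lemma PLo_simps:
  "carrier PLo = PL_maps" "f \<otimes>\<^bsub>PLo\<^esub> g = g \<circ> f" "\<one>\<^bsub>PLo\<^esub> = id"
  by (simp_all add: PLo_def)

lemma PLo_inv:
  assumes "f \<in> PL_maps"
  shows "inv\<^bsub>PLo\<^esub> f \<in> PL_maps" "(inv\<^bsub>PLo\<^esub> f) (f x) = x" "f ((inv\<^bsub>PLo\<^esub> f) x) = x"
  using PLo.inv_closed[of f] PLo.r_inv[of f] PLo.l_inv[of f] assms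
  by (auto simp: PLo_simps fun_eq_iff)

lemma subgroup_PLoD:
  assumes "subgroup G PLo"
  shows "G \<subseteq> PL_maps" "id \<in> G" "f \<in> G \<Longrightarrow> h \<in> G \<Longrightarrow> h \<circ> f \<in> G" "f \<in> G \<Longrightarrow> inv\<^bsub>PLo\<^esub> f \<in> G"
  using subgroup.subset[OF assms] subgroup.one_closed[OF assms]
    subgroup.m_closed[OF assms, of f h] subgroup.m_inv_closed[OF assms, of f]
  by (auto simp: PLo_simps)

lemma generate_fixes:
  assumes "K \<subseteq> PL_maps" "h \<in> generate PLo K" and x: "\<And>k. k \<in> K \<Longrightarrow> k x = x"
  shows "h x = x"
  using assms(2)
proof induction
  case (inv h)
  then have "h x = x" "h \<in> PL_maps" using x assms(1) by auto
  then show ?case using PLo_inv(2)[of h x] by simp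
qed (use x in \<open>auto simp: PLo_simps\<close>)

lemma component_generate:
  assumes "K \<subseteq> PL_maps"
  shows "component (generate PLo K) p q \<longleftrightarrow> component K p q"
proof
  assume c: "component (generate PLo K) p q"
  then have "\<exists>k\<in>K. k x \<noteq> x" if "x \<in> {p<..<q}" for x
    using that generate_fixes[OF assms, of _ x] unfolding component_def by metis
  then show "component K p q" using c by (auto simp: component_def intro: generate.incl)
next
  assume "component K p q"
  then show "component (generate PLo K) p q"
    using generate_fixes[OF assms] unfolding component_def by (metis generate.incl)
qed

lemma component_bounds:
  assumes G: "G \<subseteq> PL_maps" and c: "component G p q"
  shows "0 \<le> p" "q \<le> 1" "p < 1" "0 < q"
proof -
  have "p < q" using c by (simp add: component_def)
  have inside: "0 < x \<and> x < 1" if "p < x" "x < q" for x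
  proof (rule ccontr)
    assume "\<not> ?thesis"
    then have "k x = x" if "k \<in> G" for k
      using PL_map_fixed_outside[of k x] G that by force
    then show False using c that unfolding component_def by (metis greaterThanLessThan_iff)
  qed
  show "0 \<le> p"
    using inside dense[of p "min q 0"] \<open>p < q\<close> by fastforce
  show "q \<le> 1"
    using inside dense[of "max p 1" q] \<open>p < q\<close> by fastforce
  show "p < 1" "0 < q" using \<open>0 \<le> p\<close> \<open>q \<le> 1\<close> \<open>p < q\<close> by auto
qed

text \<open>The inverse of \<open>k\<close> maps \<open>S\<close> into itself too, which turns
  inclusion into equality.\<close>

lemma subgroup_image_eq:
  assumes G: "subgroup G PLo" and k: "k \<in> G" and sub: "\<And>h z. h \<in> G \<Longrightarrow> z \<in> S \<Longrightarrow> h z \<in> S"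
  shows "k ` S = S"
proof (intro equalityI subsetI)
  fix z assume "z \<in> S"
  then have "(inv\<^bsub>PLo\<^esub> k) z \<in> S" using sub subgroup_PLoD(4)[OF G k] by blast
  moreover have "k ((inv\<^bsub>PLo\<^esub> k) z) = z" using PLo_inv(3) subgroup_PLoD(1)[OF G] k by blast
  ultimately show "z \<in> k ` S" by (metis imageI)
qed (use sub k in auto)

lemma component_mem:
  assumes "G \<subseteq> PL_maps" "component G p q" "k \<in> G" "p < x" "x < q"
  shows "p < k x" "k x < q"
  using component_mem_iff[OF PL_map_order_bij, of k p q x] assms by (auto simp: component_def)

text \<open>The orbit of \<open>x\<close> is an invariant subset of (p, q), so
  \<open>component_invariant_unbounded\<close> applies. This is the source of elements that move a
  point as far as desired.\<close>

lemma component_orbit: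
  assumes G: "subgroup G PLo" and c: "component G p q" and x: "p < x" "x < q"
  shows "p < y \<Longrightarrow> \<exists>k\<in>G. k x < y" "y < q \<Longrightarrow> \<exists>k\<in>G. y < k x"
proof -
  note GP = subgroup_PLoD(1)[OF G]
  define S where "S = (\<lambda>k. k x) ` G"
  have S: "S \<subseteq> {p<..<q}" "S \<noteq> {}"
    using component_mem[OF GP c _ x] subgroup_PLoD(2)[OF G] by (auto simp: S_def)
  have inv: "k ` S = S" if "k \<in> G" for k
  proof (rule subgroup_image_eq[OF G that])
    fix h z assume h: "h \<in> G" and "z \<in> S"
    then obtain k where k: "k \<in> G" "z = k x" by (auto simp: S_def)
    then have "h z = (h \<circ> k) x" by simp
    then show "h z \<in> S" using subgroup_PLoD(3)[OF G k(1) h] unfolding S_def by blast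
  qed
  have ob: "\<And>k. k \<in> G \<Longrightarrow> order_bij k" using GP PL_map_order_bij by blast
  show "p < y \<Longrightarrow> \<exists>k\<in>G. k x < y" "y < q \<Longrightarrow> \<exists>k\<in>G. y < k x"
    using component_invariant_unbounded[OF ob c S inv, of y] by (auto simp: S_def)
qed

lemma PL_component_exists:
  assumes "G \<subseteq> PL_maps" "k \<in> G" "k x \<noteq> x"
  obtains p q where "component G p q" "p < x" "x < q"
  using component_exists[of G k x] assms PL_map_order_bij PL_map_fixed_outside by blast

section \<open>Orbitals as components\<close>

lemma convex_hull_orbit:
  assumes G: "subgroup G PLo" and c: "component G p q" and x: "p < x" "x < q"
  shows "convex hull ((\<lambda>k. k x) ` G) = {p<..<q}"
proof
  show "convex hull ((\<lambda>k. k x) ` G) \<subseteq> {p<..<q}"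
    using component_mem[OF subgroup_PLoD(1)[OF G] c _ x] by (intro hull_minimal) auto
  show "{p<..<q} \<subseteq> convex hull ((\<lambda>k. k x) ` G)"
  proof
    fix y assume "y \<in> {p<..<q}"
    then obtain k l where kl: "k \<in> G" "k x < y" "l \<in> G" "y < l x"
      using component_orbit[OF G c x, of y] by auto
    have "is_interval (convex hull ((\<lambda>k. k x) ` G))"
      by (simp add: is_interval_convex_1)
    moreover have "k x \<in> convex hull ((\<lambda>k. k x) ` G)" "l x \<in> convex hull ((\<lambda>k. k x) ` G)"
      using kl by (auto intro!: hull_inc)
    ultimately show "y \<in> convex hull ((\<lambda>k. k x) ` G)"
      using kl(2,4) by (meson less_eq_real_def mem_is_interval_1_I)
  qed
qed

text \<open>A point with a nontrivial orbit is moved by some element, so it lies in a component, and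
  this is the hull of its orbit.\<close>

lemma orbital_iff_component:
  assumes G: "subgroup G PLo"
  shows "orbital G A \<longleftrightarrow> (\<exists>p q. component G p q \<and> A = {p<..<q})"
proof
  assume "orbital G A"
  then obtain x u v where x: "A = convex hull ((\<lambda>g. g x) ` G)" "u \<in> A" "v \<in> A" "u \<noteq> v"
    unfolding orbital_def by blast
  have "\<exists>k\<in>G. k x \<noteq> x"
  proof (rule ccontr)
    assume "\<not> ?thesis"
    then have "(\<lambda>g. g x) ` G = {x}" using image_constant[OF subgroup_PLoD(2)[OF G], of x]
      image_cong[OF refl, of G "\<lambda>g. g x" "\<lambda>g. x"] by simp
    then show False using x by simp
  qed
  then obtain p q where "component G p q" "p < x" "x < q"
    using PL_component_exists[OF subgroup_PLoD(1)[OF G]] by blast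
  then show "\<exists>p q. component G p q \<and> A = {p<..<q}"
    using convex_hull_orbit[OF G] x(1) by blast
next
  assume "\<exists>p q. component G p q \<and> A = {p<..<q}"
  then obtain p q where c: "component G p q" and A: "A = {p<..<q}" by blast
  have pq: "p < q" using c by (simp add: component_def)
  define x where "x = (p + q) / 2"
  have x: "p < x" "x < q" using pq by (auto simp: x_def)
  have "x \<in> {0..1}" using component_bounds[OF subgroup_PLoD(1)[OF G] c] x by auto
  moreover have "A = convex hull ((\<lambda>g. g x) ` G)" using convex_hull_orbit[OF G c x] A by simp
  moreover have "x \<in> A" "(p + x) / 2 \<in> A" "x \<noteq> (p + x) / 2" using x A by auto
  ultimately show "orbital G A" unfolding orbital_def by blast
qed

lemma element_orbital_iff_component:
  assumes "g \<in> PL_maps"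
  shows "element_orbital g A \<longleftrightarrow> (\<exists>a b. component {g} a b \<and> A = {a<..<b})"
  using orbital_iff_component[of "generate PLo {g}"] component_generate[of "{g}"]
    PLo.generate_is_subgroup[of "{g}"] assms
  by (simp add: element_orbital_def PLo_simps)

section \<open>Germs at fixed points and commutators\<close>

text \<open>The sign \<open>s = 1\<close> selects the right germ at a point, \<open>s = - 1\<close> the left germ.\<close>

definition germ_id :: "real \<Rightarrow> real \<Rightarrow> (real \<Rightarrow> real) \<Rightarrow> bool" where
  "germ_id s p f \<longleftrightarrow> (\<exists>e>0. \<forall>t\<in>{0..e}. f (p + s * t) = p + s * t)"

text \<open>Keeps germs inside [0, 1]: it rules out the left germ at 0 and the right germ at
  1.\<close>

definition inner_side :: "real \<Rightarrow> real \<Rightarrow> bool" where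
  "inner_side s p \<longleftrightarrow> s = 1 \<and> 0 \<le> p \<and> p < 1 \<or> s = - 1 \<and> 0 < p \<and> p \<le> 1"

text \<open>Next to \<open>p\<close> there is an interval without breaks, where \<open>f\<close> is
  affine. Continuity at the fixed point \<open>p\<close> then leaves only the slope free.\<close>

lemma affine_germ:
  assumes f: "f \<in> PL_maps" and s: "inner_side s p" and fp: "f p = p"
  obtains m e where "0 < m" "0 < e" "\<And>t. t \<in> {0..e} \<Longrightarrow> f (p + s * t) = p + s * (m * t)"
proof -
  obtain P where P: "finite P"
    "\<And>a b. a < b \<Longrightarrow> {a<..<b} \<subseteq> {0..1} - P \<Longrightarrow> \<exists>m c. \<forall>x\<in>{a<..<b}. f x = m * x + c"
    using f unfolding PL_maps_def finitely_many_breaks_def by blast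
  obtain d where d: "0 < d" "\<And>x. x \<in> P \<Longrightarrow> x \<noteq> p \<Longrightarrow> d \<le> dist p x"
    using finite_set_avoid[OF P(1), of p] by blast
  \<comment> \<open>\<open>d\<close> keeps away from the other breaks, the second bound keeps the
    interval inside [0, 1].\<close>
  define e where "e = min d (if s = 1 then 1 - p else p)"
  have e: "0 < e" "e \<le> d" using d s by (auto simp: e_def inner_side_def)
  define a where "a = (if s = 1 then p else p - e)"
  have notP: "x \<notin> P" if "a < x" "x < a + e" for x
  proof
    assume "x \<in> P"
    moreover have "x \<noteq> p" "dist p x < e" using that s e
      by (auto simp: a_def inner_side_def dist_real_def split: if_splits)
    ultimately show False using d(2)[of x] e by auto
  qed
  have "{a<..<a + e} \<subseteq> {0..1} - P"
    using notP s by (auto simp: a_def e_def inner_side_def split: if_splits)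
  then obtain m c where mc: "\<And>x. x \<in> {a<..<a + e} \<Longrightarrow> f x = m * x + c"
    using P(2)[of a "a + e"] e by auto
  have ft: "f (p + s * t) = m * (p + s * t) + c" if "0 < t" "t < e" for t
    using mc[of "p + s * t"] that s by (auto simp: a_def inner_side_def split: if_splits)
  \<comment> \<open>\<open>p\<close> may be a break itself, so the affine formula is known only for
    positive \<open>t\<close>; its limit at 0 gives p = m * p + c.\<close>
  have "isCont f p"
    using order_bij_continuous[OF PL_map_order_bij[OF f]] by (simp add: continuous_on_eq_continuous_at)
  then have lim: "((\<lambda>t. f (p + s * t)) \<longlongrightarrow> f p) (at_right 0)"
    by (rule isCont_tendsto_compose) (auto intro!: tendsto_eq_intros)
  have "((\<lambda>t. m * (p + s * t) + c) \<longlongrightarrow> m * p + c) (at_right 0)"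
    by (auto intro!: tendsto_eq_intros)
  moreover have "eventually (\<lambda>t. m * (p + s * t) + c = f (p + s * t)) (at_right 0)"
    using ft e by (auto simp: eventually_at_right_field)
  ultimately have "((\<lambda>t. f (p + s * t)) \<longlongrightarrow> m * p + c) (at_right 0)"
    by (rule Lim_transform_eventually)
  then have p: "p = m * p + c"
    using tendsto_unique[OF trivial_limit_at_right_real lim] fp by simp
  have eq: "f (p + s * t) = p + s * (m * t)" if "t \<in> {0..e / 2}" for t
  proof (cases "t = 0")
    case False
    then have "f (p + s * t) = m * p + c + s * (m * t)"
      using ft[of t] that e by (simp add: algebra_simps)
    then show ?thesis using p by simp
  qed (simp add: fp)
  have "0 < m"
  proof -
    have "f (p + s * (e / 2)) = p + s * (m * (e / 2))" using eq[of "e / 2"] e by auto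
    moreover have "f p < f (p + e / 2)" "f (p - e / 2) < f p"
      using order_bij_less[OF PL_map_order_bij[OF f]] e by auto
    ultimately have "0 < m * e" using fp s by (auto simp: inner_side_def)
    then show ?thesis using e by (simp add: zero_less_mult_iff)
  qed
  then show ?thesis using that[of m "e / 2"] eq e by auto
qed

text \<open>In the coordinate \<open>t\<close> both germs are multiplication by a slope.\<close>

lemma germs_commute:
  assumes f: "f \<in> PL_maps" "f p = p" and h: "h \<in> PL_maps" "h p = p" and s: "inner_side s p"
  obtains e where "0 < e" "\<And>t. t \<in> {0..e} \<Longrightarrow> f (h (p + s * t)) = h (f (p + s * t))"
proof -
  obtain m d where m: "0 < m" "0 < d" "\<And>t. t \<in> {0..d} \<Longrightarrow> f (p + s * t) = p + s * (m * t)"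
    using affine_germ[OF f(1) s f(2)] by blast
  obtain l c where l: "0 < l" "0 < c" "\<And>t. t \<in> {0..c} \<Longrightarrow> h (p + s * t) = p + s * (l * t)"
    using affine_germ[OF h(1) s h(2)] by blast
  \<comment> \<open>The last two bounds give l * t <= d and m * t <= c, so the map applied second
    also acts in its linear range.\<close>
  define e where "e = min (min d c) (min (d / l) (c / m))"
  have "f (h (p + s * t)) = h (f (p + s * t))" if t: "t \<in> {0..e}" for t
  proof -
    have "t \<le> d" "t \<le> c" "t \<le> d / l" "t \<le> c / m" "0 \<le> t" using t by (auto simp: e_def)
    then have "t \<in> {0..d}" "t \<in> {0..c}" "l * t \<in> {0..d}" "m * t \<in> {0..c}"
      using m(1) l(1) by (auto simp: field_simps)
    then have "f (h (p + s * t)) = p + s * (m * (l * t))" "h (f (p + s * t)) = p + s * (l * (m * t))"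
      using m(3) l(3) by presburger+
    then show ?thesis by (simp add: mult.left_commute)
  qed
  moreover have "0 < e" using m(1,2) l(1,2) by (simp add: e_def)
  ultimately show ?thesis using that by blast
qed

lemma germ_id_compose:
  assumes "germ_id s p f" "germ_id s p h"
  shows "germ_id s p (h \<circ> f)"
proof -
  obtain d e where "0 < d" "0 < e" "\<forall>t\<in>{0..d}. f (p + s * t) = p + s * t"
    "\<forall>t\<in>{0..e}. h (p + s * t) = p + s * t"
    using assms unfolding germ_id_def by blast
  then show ?thesis unfolding germ_id_def by (intro exI[of _ "min d e"]) auto
qed

lemma commutator_eq:
  assumes "f \<in> PL_maps" "h \<in> PL_maps"
  shows "(f \<otimes>\<^bsub>PLo\<^esub> h \<otimes>\<^bsub>PLo\<^esub> inv\<^bsub>PLo\<^esub> f \<otimes>\<^bsub>PLo\<^esub> inv\<^bsub>PLo\<^esub> h) z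
           = (inv\<^bsub>PLo\<^esub> h) ((inv\<^bsub>PLo\<^esub> f) (h (f z)))"
  by (simp add: PLo_simps)

text \<open>Germs at a common fixed point commute, so commutators are trivial near \<open>p\<close>,
  and so are products of commutators and their inverses.\<close>

lemma derived_germ_id:
  assumes G: "G \<subseteq> PL_maps" and p: "\<And>k. k \<in> G \<Longrightarrow> k p = p" and s: "inner_side s p"
    and k: "k \<in> derived PLo G"
  shows "germ_id s p k"
proof -
  have comm: "germ_id s p h \<and> h \<in> PL_maps" if "h \<in> derived_set PLo G" for h
  proof
    show "h \<in> PL_maps" using PLo.derived_set_in_carrier[of G] G that by (auto simp: PLo_simps)
    obtain u v where uv: "u \<in> G" "v \<in> G"
      and h: "h = u \<otimes>\<^bsub>PLo\<^esub> v \<otimes>\<^bsub>PLo\<^esub> inv\<^bsub>PLo\<^esub> u \<otimes>\<^bsub>PLo\<^esub> inv\<^bsub>PLo\<^esub> v"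
      using \<open>h \<in> derived_set PLo G\<close> by blast
    then have uv': "u \<in> PL_maps" "v \<in> PL_maps" using G by auto
    obtain e where e: "0 < e" "\<And>t. t \<in> {0..e} \<Longrightarrow> u (v (p + s * t)) = v (u (p + s * t))"
      using germs_commute[OF uv'(1) p[OF uv(1)] uv'(2) p[OF uv(2)] s] by blast
    then have "h (p + s * t) = p + s * t" if "t \<in> {0..e}" for t
    proof -
      have "h (p + s * t) = (inv\<^bsub>PLo\<^esub> v) ((inv\<^bsub>PLo\<^esub> u) (v (u (p + s * t))))"
        unfolding h by (rule commutator_eq[OF uv'])
      then show ?thesis unfolding e(2)[OF that, symmetric] PLo_inv(2)[OF uv'(1)] PLo_inv(2)[OF uv'(2)] .
    qed
    then show "germ_id s p h" using e(1) unfolding germ_id_def by blast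
  qed
  have "k \<in> generate PLo (derived_set PLo G)" using k by (simp only: derived_def)
  then show ?thesis
  proof (induction k rule: generate.induct)
    case one
    show ?case unfolding germ_id_def PLo_simps by (intro exI[of _ 1]) (simp add: id_def)
  next
    case (inv h)
    obtain e where e: "0 < e" "\<And>t. t \<in> {0..e} \<Longrightarrow> h (p + s * t) = p + s * t" "h \<in> PL_maps"
      using comm[OF inv] unfolding germ_id_def by blast
    have "(inv\<^bsub>PLo\<^esub> h) (p + s * t) = p + s * t" if "t \<in> {0..e}" for t
      using PLo_inv(2)[OF e(3), of "p + s * t"] e(2)[OF that] by simp
    then show ?case using e(1) unfolding germ_id_def by blast
  next
    case (incl h)
    then show ?case using comm by blast
  next
    case (eng h1 h2)
    then show ?case unfolding PLo_simps by (blast intro: germ_id_compose)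
  qed
qed

text \<open>\<open>k\<close> is the commutator of \<open>f\<close> and \<open>h\<close>; its
  relation is stated without inverses, ready for cancellation.\<close>

lemma derived_commutator:
  assumes "G \<subseteq> PL_maps" "f \<in> G" "h \<in> G"
  obtains k where "k \<in> derived PLo G" "\<And>z. f (h (k z)) = h (f z)"
proof
  let ?k = "f \<otimes>\<^bsub>PLo\<^esub> h \<otimes>\<^bsub>PLo\<^esub> inv\<^bsub>PLo\<^esub> f \<otimes>\<^bsub>PLo\<^esub> inv\<^bsub>PLo\<^esub> h"
  show "?k \<in> derived PLo G" unfolding derived_def by (rule generate.incl) (use assms in blast)
  fix z
  show "f (h (?k z)) = h (f z)"
    using assms by (subst commutator_eq) (auto simp: PLo_inv(3) subset_iff)
qed

lemma derived_subset:
  assumes "subgroup G PLo"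
  shows "derived PLo G \<subseteq> G" "subgroup (derived PLo G) PLo"
  using PLo.derived_incl[OF _ assms] PLo.derived_is_subgroup subgroup.subset[OF assms] by auto

lemma commute_at_derived_fixed:
  assumes "G \<subseteq> PL_maps" "f \<in> G" "h \<in> G" "\<And>k. k \<in> derived PLo G \<Longrightarrow> k z = z"
  shows "f (h z) = h (f z)"
  using derived_commutator[OF assms(1-3)] assms(4) by metis

lemma derived_fixed_invariant:
  assumes G: "subgroup G PLo" and c: "component G p q" and g: "g \<in> G"
    and F: "F = {z. p < z \<and> z < q \<and> (\<forall>k\<in>derived PLo G. k z = z)}"
  shows "g ` F = F"
proof (rule subgroup_image_eq[OF G g])
  note GP = subgroup_PLoD(1)[OF G]
  fix h z assume h: "h \<in> G" and z: "z \<in> F"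
  have "k (h z) = h z" if "k \<in> derived PLo G" for k
  proof -
    \<comment> \<open>As \<open>k\<close> lies in \<open>G\<close>, it commutes with
      \<open>h\<close> at \<open>z\<close>, so k (h z) = h (k z) = h z.\<close>
    have "k \<in> G" using derived_subset(1)[OF G] that by blast
    moreover have fz: "\<And>k. k \<in> derived PLo G \<Longrightarrow> k z = z" using z by (simp add: F)
    ultimately have "k (h z) = h (k z)" using commute_at_derived_fixed[OF GP _ h] by blast
    then show ?thesis by (simp only: fz[OF that])
  qed
  then show "h z \<in> F" using component_mem[OF GP c h] z by (auto simp: F)
qed

section \<open>Crossing orbitals\<close>

text \<open>In either disjunct one end of the orbital of \<open>g\<close> lies inside that of
  \<open>h\<close>. A single shared end counts as crossing. The remaining configurations arise by
  exchanging \<open>g\<close> and \<open>h\<close>.\<close>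

definition crossing :: "(real \<Rightarrow> real) set \<Rightarrow> bool" where
  "crossing G \<longleftrightarrow> (\<exists>g\<in>G. \<exists>h\<in>G. \<exists>a b c d. component {g} a b \<and> component {h} c d \<and>
     (a \<le> c \<and> c < b \<and> b < d \<or> c < a \<and> a < d \<and> d \<le> b))"

lemma component_inner_side:
  assumes "G \<subseteq> PL_maps" "component G p q"
  shows "inner_side 1 p" "inner_side (- 1) q"
  using component_bounds[OF assms] by (auto simp: inner_side_def)

lemma component_moved: "component K p q \<Longrightarrow> p < z \<Longrightarrow> z < q \<Longrightarrow> \<exists>k\<in>K. k z \<noteq> z"
  by (simp add: component_def)

lemma component_nontrivial:
  assumes "component K p q"
  shows "\<exists>k\<in>K. k \<noteq> id"
proof -
  obtain z where "p < z" "z < q" using assms dense[of p q] by (auto simp: component_def)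
  then obtain k where "k \<in> K" "k z \<noteq> z" using component_moved[OF assms] by blast
  then show ?thesis by (intro bexI[of _ k]) auto
qed

text \<open>\<open>K\<close> is the derived subgroup of the group generated by \<open>g\<close> and
  \<open>h\<close>. The two lemmas on crossing intervals exclude common fixed points, and
  \<open>derived_germ_id\<close> makes the germs at the ends trivial.\<close>

lemma crossing_component_derived:
  assumes G: "subgroup G PLo" and cr: "crossing G"
  obtains K p q where "subgroup K PLo" "K \<subseteq> G" "component K p q"
    "\<And>k. k \<in> K \<Longrightarrow> germ_id 1 p k" "\<And>k. k \<in> K \<Longrightarrow> germ_id (- 1) q k"
proof -
  obtain g h a b c d where gh: "g \<in> G" "h \<in> G"
    and cg: "component {g} a b" and ch: "component {h} c d"
    and ord: "a \<le> c \<and> c < b \<and> b < d \<or> c < a \<and> a < d \<and> d \<le> b"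
    using cr unfolding crossing_def by blast
  \<comment> \<open>The end of the orbital of \<open>g\<close> inside that of \<open>h\<close>. As
    \<open>h\<close> moves it, it selects the component (p, q).\<close>
  define w where "w = (if a \<le> c then b else a)"
  have w: "c < w" "w < d" using ord by (auto simp: w_def)
  have P: "{g, h} \<subseteq> PL_maps" using gh subgroup_PLoD(1)[OF G] by auto
  define H where "H = generate PLo {g, h}"
  have H: "subgroup H PLo" and HG: "H \<subseteq> G"
    using PLo.generate_is_subgroup[of "{g, h}"] PLo.generate_subgroup_incl[OF _ G, of "{g, h}"] P gh
    by (auto simp: H_def PLo_simps)
  note HP = subgroup_PLoD(1)[OF H]
  have gH: "g \<in> H" "h \<in> H" by (auto simp: H_def intro: generate.incl)
  have "h w \<noteq> w" using ch w by (auto simp: component_def)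
  then obtain p q where c: "component {g, h} p q" and pq: "p < w" "w < q"
    using PL_component_exists[OF P, of h w] by blast
  have cH: "component H p q" using component_generate[OF P] c by (simp add: H_def)
  define K where "K = derived PLo H"
  have KH: "K \<subseteq> H" and K: "subgroup K PLo" using derived_subset[OF H] by (auto simp: K_def)
  define F where "F = {z. p < z \<and> z < q \<and> (\<forall>k\<in>K. k z = z)}"
  have FK: "F = {z. p < z \<and> z < q \<and> (\<forall>k\<in>derived PLo H. k z = z)}" by (simp add: F_def K_def)
  have gF: "g ` F = F" and hF: "h ` F = F"
    using derived_fixed_invariant[OF H cH _ FK] gH by auto
  have comm: "g (h z) = h (g z)" if "z \<in> F" for z
    using that by (intro commute_at_derived_fixed[OF HP gH]) (simp add: FK)
  have ob: "order_bij g" "order_bij h" "\<And>k. k \<in> K \<Longrightarrow> order_bij k"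
    using HP KH gH PL_map_order_bij by blast+
  have "F = {}"
  proof (cases "a \<le> c")
    case True
    then show ?thesis
      using ord pq w
      by (intro crossing_no_common_fixed_left[OF ob cg ch c _ _ _ _ _ F_def gF hF comm])
        (auto simp: w_def)
  next
    case False
    then show ?thesis
      using ord pq w
      by (intro crossing_no_common_fixed_right[OF ob cg ch c _ _ _ _ _ F_def gF hF comm])
        (auto simp: w_def)
  qed
  then have "\<exists>k\<in>K. k z \<noteq> z" if "p < z" "z < q" for z using that by (auto simp: F_def)
  moreover have "k p = p" "k q = q" if "k \<in> H" for k using that cH by (auto simp: component_def)
  ultimately have cK: "component K p q" using cH KH by (auto simp: component_def)
  have "germ_id 1 p k" "germ_id (- 1) q k" if "k \<in> K" for k
    using that cH component_inner_side[OF HP cH]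
    by (auto intro!: derived_germ_id[OF HP] simp: K_def component_def)
  then show ?thesis using that[OF K _ cK] KH HG by blast
qed

text \<open>At a point \<open>z\<close> fixed by the derived subgroup any two elements of
  \<open>K\<close> commute. Given \<open>k\<close>, some \<open>u\<close> moves \<open>z\<close> to
  where \<open>k\<close> is trivial; then u (k z) = k (u z) = u z, so every \<open>k\<close> fixes
  \<open>z\<close>.\<close>

lemma derived_component:
  assumes K: "subgroup K PLo" and c: "component K p q"
    and germ: "\<And>k. k \<in> K \<Longrightarrow> germ_id 1 p k"
  shows "component (derived PLo K) p q"
proof -
  note KP = subgroup_PLoD(1)[OF K]
  have "\<exists>k\<in>derived PLo K. k z \<noteq> z" if z: "p < z" "z < q" for z
  proof (rule ccontr)
    assume "\<not> ?thesis"
    then have fz: "k z = z" if "k \<in> derived PLo K" for k using that by blast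
    have "k z = z" if k: "k \<in> K" for k
    proof -
      obtain e where e: "0 < e" "\<forall>t\<in>{0..e}. k (p + 1 * t) = p + 1 * t"
        using germ[OF k] unfolding germ_id_def by blast
      obtain u where u: "u \<in> K" "u z < p + e"
        using component_orbit(1)[OF K c z, of "p + e"] e(1) by auto
      have "p < u z" using component_mem(1)[OF KP c u(1) z] .
      then have "k (u z) = u z" using bspec[OF e(2), of "u z - p"] u(2) by simp
      moreover have "k (u z) = u (k z)"
        using commute_at_derived_fixed[OF KP k u(1)] fz by blast
      ultimately show ?thesis
        using order_bij_eq[OF PL_map_order_bij, of u "k z" z] u(1) KP by auto
    qed
    then show False using c z unfolding component_def by (metis greaterThanLessThan_iff)
  qed
  moreover have "k p = p" "k q = q" if "k \<in> derived PLo K" for k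
    using that c derived_subset(1)[OF K] by (auto simp: component_def)
  ultimately show ?thesis using c by (auto simp: component_def)
qed

text \<open>The germ condition passes to subgroups, so \<open>derived_component\<close> can be
  iterated, and all terms of the derived series of \<open>K\<close> keep the component (p,
  q).\<close>

lemma crossing_derived_series:
  assumes G: "subgroup G PLo" and cr: "crossing G"
  shows "(derived PLo ^^ n) G \<noteq> {id}"
proof -
  obtain K p q where K: "subgroup K PLo" "K \<subseteq> G" "component K p q"
    "\<And>k. k \<in> K \<Longrightarrow> germ_id 1 p k"
    using crossing_component_derived[OF assms] by metis
  have "(derived PLo ^^ n) K \<subseteq> K \<and> subgroup ((derived PLo ^^ n) K) PLo \<and>
      component ((derived PLo ^^ n) K) p q"
  proof (induction n)
    case (Suc n)
    let ?D = "(derived PLo ^^ n) K"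
    have D: "?D \<subseteq> K" "subgroup ?D PLo" "component ?D p q" using Suc by blast+
    have "germ_id 1 p k" if "k \<in> ?D" for k using K(4) D(1) that by blast
    then have "component (derived PLo ?D) p q" by (rule derived_component[OF D(2,3)])
    moreover have "derived PLo ?D \<subseteq> K" using derived_subset(1)[OF D(2)] D(1) by blast
    ultimately show ?case using derived_subset(2)[OF D(2)] by simp
  qed (use K in simp)
  then have "component ((derived PLo ^^ n) K) p q" by blast
  then have "\<exists>k\<in>(derived PLo ^^ n) K. k \<noteq> id" by (rule component_nontrivial)
  then obtain k where k: "k \<in> (derived PLo ^^ n) K" "k \<noteq> id" by blast
  then have "k \<in> (derived PLo ^^ n) G" using subsetD[OF PLo.mono_exp_of_derived[OF K(2)]] by simp
  then show ?thesis using k(2) by (metis singletonD)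
qed

section \<open>Towers\<close>

text \<open>\<open>tall G n a b\<close>: there is a tower of height \<open>n\<close> whose largest orbital is \<open>{a<..<b}\<close>.\<close>

inductive tall :: "(real \<Rightarrow> real) set \<Rightarrow> nat \<Rightarrow> real \<Rightarrow> real \<Rightarrow> bool" for G where
  tall_base: "g \<in> G \<Longrightarrow> component {g} a b \<Longrightarrow> tall G (Suc 0) a b"
| tall_step: "tall G n a b \<Longrightarrow> g \<in> G \<Longrightarrow> component {g} c d \<Longrightarrow> c \<le> a \<Longrightarrow> b \<le> d \<Longrightarrow>
    (a, b) \<noteq> (c, d) \<Longrightarrow> tall G (Suc n) c d"

lemma tall_mono:
  assumes "tall K n a b" "K \<subseteq> G"
  shows "tall G n a b"
  using assms by induction (auto intro: tall.intros)

lemma tall_top: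
  assumes "tall G n a b"
  obtains g where "g \<in> G" "component {g} a b"
  using assms by cases auto

text \<open>Uniqueness of signatures gives distinct members distinct orbitals, so comparing them
  under \<open>signed_le\<close> means strict inclusion of orbitals.\<close>

lemma tower_iff:
  "tower G T \<longleftrightarrow> T \<subseteq> signed_orbitals G \<and>
     (\<forall>R\<in>T. \<forall>S\<in>T. R \<noteq> S \<longrightarrow> fst R \<subset> fst S \<or> fst S \<subset> fst R)"
proof (intro iffI conjI ballI impI)
  assume t: "tower G T"
  then show "T \<subseteq> signed_orbitals G" by (simp add: tower_def)
  fix R S assume RS: "R \<in> T" "S \<in> T" "R \<noteq> S"
  have "fst R \<noteq> fst S"
  proof
    assume "fst R = fst S"
    moreover have "\<exists>!g. (fst R, g) \<in> T" using t RS(1) unfolding tower_def by blast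
    ultimately have "snd R = snd S" using RS(1,2) by (metis prod.collapse)
    then show False using RS(3) \<open>fst R = fst S\<close> by (simp add: prod_eq_iff)
  qed
  moreover have "signed_le R S \<or> signed_le S R"
    using t RS(1,2) unfolding tower_def Complete_Partial_Order.chain_def by blast
  ultimately show "fst R \<subset> fst S \<or> fst S \<subset> fst R" unfolding signed_le_def by metis
next
  assume t: "T \<subseteq> signed_orbitals G \<and>
     (\<forall>R\<in>T. \<forall>S\<in>T. R \<noteq> S \<longrightarrow> fst R \<subset> fst S \<or> fst S \<subset> fst R)"
  show "tower G T" unfolding tower_def
  proof (intro conjI ballI)
    show "T \<subseteq> signed_orbitals G" using t by blast
    show "Complete_Partial_Order.chain signed_le T"
      unfolding Complete_Partial_Order.chain_def
    proof (intro ballI)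
      fix R S assume "R \<in> T" "S \<in> T"
      then consider "R = S" | "fst R \<subset> fst S" | "fst S \<subset> fst R" using t by blast
      then show "signed_le R S \<or> signed_le S R"
        by cases (simp_all add: signed_le_def left_le_def)
    qed
    fix A assume "A \<in> fst ` T"
    then obtain g where g: "(A, g) \<in> T" by auto
    have "h = g" if "(A, h) \<in> T" for h
    proof (rule ccontr)
      assume "h \<noteq> g"
      then show False using bspec[OF bspec[OF conjunct2[OF t] that] g] by simp
    qed
    then show "\<exists>!g. (A, g) \<in> T" using g by blast
  qed
qed

lemma tower_mono:
  assumes T: "tower G T" and S: "S \<subseteq> T"
  shows "tower G S"
  unfolding tower_iff
proof (intro conjI ballI impI)
  show "S \<subseteq> signed_orbitals G" using T S unfolding tower_iff by (elim conjE) (rule subset_trans)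
  fix Q R assume "Q \<in> S" "R \<in> S" and ne: "Q \<noteq> R"
  then have "Q \<in> T" "R \<in> T" using S by (simp_all only: subsetD)
  then show "fst Q \<subset> fst R \<or> fst R \<subset> fst Q" using T ne unfolding tower_iff by (elim conjE) simp
qed

lemma component_less: "component K p q \<Longrightarrow> p < q"
  by (simp add: component_def)

lemma tall_less: "tall G n a b \<Longrightarrow> a < b"
  by (erule tall_top) (rule component_less)

lemma signed_orbitals_component:
  assumes "G \<subseteq> PL_maps"
  shows "g \<in> G \<Longrightarrow> component {g} a b \<Longrightarrow> ({a<..<b}, g) \<in> signed_orbitals G"
    and "(A, g) \<in> signed_orbitals G \<Longrightarrow> g \<in> G \<and> (\<exists>a b. component {g} a b \<and> A = {a<..<b})"
proof -
  have iff: "(A, g) \<in> signed_orbitals G \<longleftrightarrow> g \<in> G \<and> element_orbital g A" for A g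
    by (simp add: signed_orbitals_def)
  have orb: "element_orbital g A \<longleftrightarrow> (\<exists>a b. component {g} a b \<and> A = {a<..<b})" if "g \<in> G" for A g
    using that assms element_orbital_iff_component by blast
  show "g \<in> G \<Longrightarrow> component {g} a b \<Longrightarrow> ({a<..<b}, g) \<in> signed_orbitals G"
    unfolding iff using orb by metis
  show "(A, g) \<in> signed_orbitals G \<Longrightarrow> g \<in> G \<and> (\<exists>a b. component {g} a b \<and> A = {a<..<b})"
    unfolding iff using orb by metis
qed

text \<open>The last conjunct serves the induction: all orbitals so far lie strictly below the next
  one, so the new pair is not yet in the tower.\<close>

lemma tall_imp_tower:
  assumes "tall G n a b" and G: "G \<subseteq> PL_maps"
  shows "\<exists>T. tower G T \<and> finite T \<and> card T = n \<and> (\<forall>S\<in>T. fst S \<subseteq> {a<..<b})"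
  using assms(1)
proof (induction rule: tall.induct)
  case (tall_base g a b)
  then have "({a<..<b}, g) \<in> signed_orbitals G"
    by (rule signed_orbitals_component(1)[OF G])
  then have "tower G {({a<..<b}, g)}" by (simp add: tower_iff)
  then show ?case by (intro exI[of _ "{({a<..<b}, g)}"]) simp
next
  case (tall_step n a b g c d)
  then obtain T where T: "tower G T" "finite T" "card T = n" "\<forall>S\<in>T. fst S \<subseteq> {a<..<b}" by blast
  have g: "({c<..<d}, g) \<in> signed_orbitals G"
    by (rule signed_orbitals_component(1)[OF G tall_step.hyps(2,3)])
  have "{a<..<b} \<subset> {c<..<d}"
    using tall_step.hyps(4-6) tall_less[OF tall_step.hyps(1)]
    by (simp add: psubset_eq greaterThanLessThan_subseteq_greaterThanLessThan greaterThanLessThan_eq_iff)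
  then have lt: "fst S \<subset> {c<..<d}" if "S \<in> T" for S using T(4) that by blast
  then have "({c<..<d}, g) \<notin> T" by fastforce
  then have "card (insert ({c<..<d}, g) T) = Suc n" using T(2,3) by simp
  moreover have "tower G (insert ({c<..<d}, g) T)"
    using T(1) g lt by (simp add: tower_iff)
  moreover have "\<forall>S\<in>insert ({c<..<d}, g) T. fst S \<subseteq> {c<..<d}"
    using psubset_imp_subset[OF lt] by simp
  moreover have "finite (insert ({c<..<d}, g) T)" using T(2) by simp
  ultimately show ?case by metis
qed

text \<open>Induction by removing the largest orbital. Membership of {a<..<b} in the orbitals of
  \<open>T\<close> allows comparing the top of the remaining tower with the removed orbital.\<close>

lemma tower_imp_tall:
  assumes G: "G \<subseteq> PL_maps"
  shows "tower G T \<Longrightarrow> finite T \<Longrightarrow> card T = Suc n \<Longrightarrow>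
    \<exists>a b. tall G (Suc n) a b \<and> {a<..<b} \<in> fst ` T"
proof (induction n arbitrary: T)
  case (Suc n)
  obtain M where M: "M \<in> fst ` T" "\<forall>S\<in>fst ` T. M \<subseteq> S \<longrightarrow> M = S"
  proof -
    have fin: "finite (fst ` T)" and ne: "fst ` T \<noteq> {}" using Suc.prems(2,3) by auto
    show ?thesis by (rule bexE[OF finite_has_maximal[OF fin ne]]) (rule that)
  qed
  then obtain g where g: "(M, g) \<in> T" by auto
  have top: "S \<subset> M" if S: "(S, f) \<in> T - {(M, g)}" for S f
  proof -
    have "fst (S, f) \<subset> fst (M, g) \<or> fst (M, g) \<subset> fst (S, f)"
    proof -
      have sub: "\<forall>R\<in>T. \<forall>S\<in>T. R \<noteq> S \<longrightarrow> fst R \<subset> fst S \<or> fst S \<subset> fst R"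
        using Suc.prems(1) unfolding tower_iff by (rule conjunct2)
      show ?thesis using bspec[OF bspec[OF sub] g, of "(S, f)"] S by simp
    qed
    moreover have "S \<in> fst ` T" using S by (intro image_eqI[of _ _ "(S, f)"]) auto
    ultimately show ?thesis using M(2) by auto
  qed
  have "tower G (T - {(M, g)})" by (rule tower_mono[OF Suc.prems(1)]) blast
  moreover have "finite (T - {(M, g)})" "card (T - {(M, g)}) = Suc n"
    using Suc.prems(2,3) g by simp_all
  ultimately obtain a b where ab: "tall G (Suc n) a b" "{a<..<b} \<in> fst ` (T - {(M, g)})"
    using Suc.IH by blast
  have "(M, g) \<in> signed_orbitals G" using Suc.prems(1) g unfolding tower_iff by blast
  then obtain c d where cd: "g \<in> G" "component {g} c d" "M = {c<..<d}"
    using signed_orbitals_component(2)[OF G] by metis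
  obtain R where R: "{a<..<b} = fst R" "R \<in> T - {(M, g)}" using ab(2) by (rule imageE)
  then have "{a<..<b} \<subset> {c<..<d}" using top[of "fst R" "snd R"] cd(3) by simp
  moreover have "a < b" using ab(1) by (rule tall_less)
  ultimately have "c \<le> a" "b \<le> d" "(a, b) \<noteq> (c, d)"
    by (auto simp: psubset_eq greaterThanLessThan_subseteq_greaterThanLessThan)
  then have "tall G (Suc (Suc n)) c d" by (rule tall_step[OF ab(1) cd(1,2)])
  then show ?case using cd(3) M(1) by (intro exI conjI) simp_all
next
  case 0
  then obtain M g where T: "T = {(M, g)}" by (auto simp: card_1_singleton_iff)
  then have "(M, g) \<in> signed_orbitals G" using 0 by (auto simp: tower_iff)
  then obtain c d where "g \<in> G" "component {g} c d" "M = {c<..<d}"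
    using signed_orbitals_component(2)[OF G] by metis
  then have "tall G (Suc 0) c d" "{c<..<d} \<in> fst ` T" using T tall_base[of g G c d] by simp_all
  then show ?case by (intro exI conjI)
qed

text \<open>Subsets of towers are towers, so a higher or infinite tower contains one of height
  exactly \<open>Suc n\<close>.\<close>

lemma depth_ge_iff_tall:
  assumes G: "G \<subseteq> PL_maps"
  shows "enat (Suc n) \<le> depth G \<longleftrightarrow> (\<exists>a b. tall G (Suc n) a b)"
proof
  assume deep: "enat (Suc n) \<le> depth G"
  show "\<exists>a b. tall G (Suc n) a b"
  proof (rule ccontr)
    assume none: "\<not> ?thesis"
    have "height T \<le> enat n" if T: "tower G T" for T
    proof (rule ccontr)
      assume "\<not> ?thesis"
      then have "infinite T \<or> Suc n \<le> card T" by (auto simp: height_def split: if_splits)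
      then have "\<exists>S. finite S \<and> card S = Suc n \<and> S \<subseteq> T"
      proof
        assume "Suc n \<le> card T"
        then show ?thesis by (rule obtain_subset_with_card_n) blast
      qed (rule infinite_arbitrarily_large)
      then obtain S where S: "finite S" "card S = Suc n" "S \<subseteq> T" by (elim exE conjE)
      have "\<exists>a b. tall G (Suc n) a b \<and> {a<..<b} \<in> fst ` S"
        by (rule tower_imp_tall[OF G tower_mono[OF T S(3)] S(1,2)])
      then show False using none by (elim exE conjE) simp
    qed
    then have "depth G \<le> enat n" unfolding depth_def by (intro SUP_least) auto
    then have "enat (Suc n) \<le> enat n" using deep by (rule order_trans[rotated])
    then show False by simp
  qed
next
  assume "\<exists>a b. tall G (Suc n) a b"
  then obtain T where T: "tower G T" "finite T" "card T = Suc n"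
    using tall_imp_tower[OF _ G] by blast
  then have "enat (Suc n) = height T" by (simp add: height_def)
  also have "\<dots> \<le> depth G" unfolding depth_def by (rule SUP_upper) (use T in simp)
  finally show "enat (Suc n) \<le> depth G" .
qed

text \<open>Take \<open>k\<close> with y < k x and its orbital around \<open>x\<close>. The right
  end is fixed by \<open>k\<close>, hence beyond \<open>y\<close>; and \<open>k\<close> is trivial
  near \<open>p\<close> and \<open>q\<close>, so both ends stay away from them.\<close>

lemma element_component_between:
  assumes K: "subgroup K PLo" and c: "component K p q"
    and germ: "\<And>k. k \<in> K \<Longrightarrow> germ_id 1 p k" "\<And>k. k \<in> K \<Longrightarrow> germ_id (- 1) q k"
    and xy: "p < x" "x < y" "y < q"
  obtains k a b where "k \<in> K" "component {k} a b" "p < a" "a < x" "y < b" "b < q"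
proof -
  note KP = subgroup_PLoD(1)[OF K]
  obtain k where k: "k \<in> K" "y < k x" using component_orbit(2)[OF K c, of x y] xy by auto
  have kP: "{k} \<subseteq> PL_maps" and ob: "order_bij k" using k(1) KP PL_map_order_bij by auto
  obtain a b where ab: "component {k} a b" "a < x" "x < b"
    using PL_component_exists[OF kP, of k x] k(2) xy by auto
  have fx: "k a = a" "k b = b" "k p = p" "k q = q"
    using ab(1) c k(1) by (auto simp: component_def)
  have "y < b" using order_bij_less[OF ob, of x b] fx k(2) ab(3) by auto
  obtain d where d: "0 < d" "\<forall>t\<in>{0..d}. k (p + 1 * t) = p + 1 * t"
    using germ(1)[OF k(1)] unfolding germ_id_def by blast
  obtain e where e: "0 < e" "\<forall>t\<in>{0..e}. k (q + - 1 * t) = q + - 1 * t"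
    using germ(2)[OF k(1)] unfolding germ_id_def by blast
  define d' where "d' = min d ((x - p) / 2)"
  have d': "0 < d'" "d' \<le> d" "p + d' < x" using d(1) xy by (auto simp: d'_def min_def field_simps)
  have "k (p + d') = p + d'" using bspec[OF d(2), of d'] d' by simp
  then have "p < a" using component_fixed_outside[OF ab(1), of "p + d'"] ab(3) d' by linarith
  define e' where "e' = min e ((q - y) / 2)"
  have e': "0 < e'" "e' \<le> e" "y < q - e'" using e(1) xy by (auto simp: e'_def min_def field_simps)
  have "k (q - e') = q - e'" using bspec[OF e(2), of e'] e' by simp
  then have "b < q" using component_fixed_outside[OF ab(1), of "q - e'"] ab(2) e' xy by linarith
  then show ?thesis using that k(1) ab \<open>p < a\<close> \<open>y < b\<close> by blast
qed

text \<open>The induction keeps the top orbital away from \<open>p\<close> and \<open>q\<close>,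
  which leaves room for a strictly larger one.\<close>

lemma crossing_tall:
  assumes G: "subgroup G PLo" and cr: "crossing G"
  shows "\<exists>a b. tall G (Suc n) a b"
proof -
  obtain K p q where K: "subgroup K PLo" "K \<subseteq> G" "component K p q"
    "\<And>k. k \<in> K \<Longrightarrow> germ_id 1 p k" "\<And>k. k \<in> K \<Longrightarrow> germ_id (- 1) q k"
    using crossing_component_derived[OF assms] by metis
  have "\<exists>a b. tall K (Suc n) a b \<and> p < a \<and> b < q"
  proof (induction n)
    case 0
    have "p < q" using K(3) by (simp add: component_def)
    then obtain x y where "p < x" "x < y" "y < q" by (meson dense)
    then obtain k a b where "k \<in> K" "component {k} a b" "p < a" "b < q"
      using element_component_between[OF K(1,3-5), of x y] by metis
    then show ?case using tall_base by blast
  next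
    case (Suc n)
    then obtain a b where ab: "tall K (Suc n) a b" "p < a" "b < q" by blast
    have "a < b" using ab(1) by (rule tall_less)
    then obtain k c d where "k \<in> K" "component {k} c d" "p < c" "c < a" "b < d" "d < q"
      using element_component_between[OF K(1,3-5), of a b] ab by metis
    then have "tall K (Suc (Suc n)) c d" by (intro tall_step[OF ab(1)]) auto
    then show ?case using \<open>p < c\<close> \<open>d < q\<close> by blast
  qed
  then show ?thesis using tall_mono[OF _ K(2)] by blast
qed

section \<open>Groups without crossing orbitals\<close>

lemma not_crossing_cases:
  assumes "\<not> crossing G" "g \<in> G" "h \<in> G" "component {g} a b" "component {h} c d" "a < d" "c < b"
  shows "a = c \<and> b = d \<or> c < a \<and> b < d \<or> a < c \<and> d < b"
proof -
  \<comment> \<open>The second statement is the first with \<open>g\<close> and \<open>h\<close>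
    exchanged.\<close>
  have "\<not> (a \<le> c \<and> c < b \<and> b < d \<or> c < a \<and> a < d \<and> d \<le> b)"
    "\<not> (c \<le> a \<and> a < d \<and> d < b \<or> a < c \<and> c < b \<and> b \<le> d)"
    using assms(1-5) unfolding crossing_def by blast+
  then show ?thesis using assms(6,7) by linarith
qed

text \<open>As \<open>g\<close> fixes \<open>y\<close>, an orbital of \<open>g\<close> meeting (c,
  d) has both ends strictly inside. So \<open>g\<close> fixes \<open>d\<close>. With slope other
  than 1 there, \<open>g\<close> would move all points just left of \<open>d\<close>, yet an orbital
  containing such a point has its right end among them.\<close>

lemma not_crossing_germ_id:
  assumes G: "subgroup G PLo" and nc: "\<not> crossing G" and gh: "g \<in> G" "h \<in> G"
    and ch: "component {h} c d" and y: "c < y" "y < d" "g y = y"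
  shows "germ_id (- 1) d g"
proof (rule ccontr)
  assume ng: "\<not> ?thesis"
  have gP: "{g} \<subseteq> PL_maps" and hP: "{h} \<subseteq> PL_maps" using gh subgroup_PLoD(1)[OF G] by auto
  have comp: "c < a \<and> b < d" if ab: "component {g} a b" "a < d" "c < b" for a b
    using not_crossing_cases[OF nc gh ab(1) ch ab(2,3)] component_fixed_outside[OF ab(1) y(3)] y
    by auto
  have gd: "g d = d"
  proof (rule ccontr)
    assume "g d \<noteq> d"
    then obtain a b where "component {g} a b" "a < d" "d < b"
      using PL_component_exists[OF gP, of g d] by blast
    then show False using comp[of a b] y by auto
  qed
  obtain m e where m: "0 < m" "0 < e" "\<And>t. t \<in> {0..e} \<Longrightarrow> g (d + - 1 * t) = d + - 1 * (m * t)"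
    by (rule affine_germ[of g "- 1" d]) (use component_inner_side(2)[OF hP ch] gd gP in auto)
  have m1: "m \<noteq> 1"
  proof
    assume "m = 1"
    then have "germ_id (- 1) d g" using m unfolding germ_id_def by auto
    then show False using ng by simp
  qed
  have moved: "g z \<noteq> z" if "d - e \<le> z" "z < d" for z
  proof
    assume "g z = z"
    then have "(m - 1) * (d - z) = 0" using m(3)[of "d - z"] that by (simp add: algebra_simps)
    then show False using m1 that by simp
  qed
  define z where "z = max (d - e) y"
  have z: "d - e \<le> z" "z < d" "c < z" using m(2) y by (auto simp: z_def)
  then obtain a b where ab: "component {g} a b" "a < z" "z < b"
    using PL_component_exists[OF gP, of g z] moved by blast
  then have "b < d" using comp[of a b] z by auto
  then show False using moved[of b] ab z by (auto simp: component_def)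
qed

text \<open>A power \<open>u\<close> of \<open>h\<close> pushes \<open>{a..b}\<close> to where \<open>g\<close> is trivial, so that the
  commutator of \<open>g\<close> and \<open>u\<close> agrees with \<open>g\<close> on \<open>{a..b}\<close>.\<close>

lemma not_crossing_commutator_component:
  assumes G: "subgroup G PLo" and nc: "\<not> crossing G" and gh: "g \<in> G" "h \<in> G"
    and cg: "component {g} a b" and ch: "component {h} c d"
    and sub: "c \<le> a" "b \<le> d" "(a, b) \<noteq> (c, d)"
  obtains k where "k \<in> derived PLo G" "component {k} a b"
proof -
  note GP = subgroup_PLoD(1)[OF G]
  have ab: "a < b" and fx: "g a = a" "g b = b" using cg by (auto simp: component_def)
  have less: "c < a" "b < d" using not_crossing_cases[OF nc gh cg ch] sub ab by auto
  have "germ_id (- 1) d g" using not_crossing_germ_id[OF G nc gh ch less(1) _ fx(1)] ab less by auto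
  then obtain e where e: "0 < e" "\<forall>t\<in>{0..e}. g (d + - 1 * t) = d + - 1 * t"
    unfolding germ_id_def by blast
  have near: "g z = z" if "d - e \<le> z" "z \<le> d" for z
    using bspec[OF e(2), of "d - z"] that by simp
  have hP: "{h} \<subseteq> PL_maps" using gh GP by auto
  have H: "subgroup (generate PLo {h}) PLo" and HG: "generate PLo {h} \<subseteq> G"
    using PLo.generate_is_subgroup[of "{h}"] PLo.generate_subgroup_incl[OF _ G, of "{h}"] hP gh
    by (auto simp: PLo_simps)
  have cH: "component (generate PLo {h}) c d" using component_generate[OF hP] ch by simp
  obtain u where u: "u \<in> generate PLo {h}" "d - e < u a"
    using component_orbit(2)[OF H cH, of a "d - e"] less ab e(1) by auto
  then have uG: "u \<in> G" using HG by blast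
  have ob: "order_bij g" "order_bij u" using gh uG GP PL_map_order_bij by auto
  obtain k where k: "k \<in> derived PLo G" "\<And>z. g (u (k z)) = u (g z)"
    using derived_commutator[OF GP gh(1) uG] by blast
  have eq: "k z = g z" if z: "a \<le> z" "z \<le> b" for z
  proof -
    have gz: "a \<le> g z" "g z \<le> b" using order_bij_le[OF ob(1)] fx z by metis+
    have "u a \<le> u (g z)" "u (g z) < d"
      using gz order_bij_le[OF ob(2)] component_mem(2)[OF subgroup_PLoD(1)[OF H] cH u(1)] less
      by auto
    then have "g (u (g z)) = u (g z)" using near u(2) by simp
    then show ?thesis using k(2)[of z] order_bij_eq[OF ob(1)] order_bij_eq[OF ob(2)] by metis
  qed
  then have "component {k} a b" using cg by (auto simp: component_def)
  then show ?thesis using that k(1) by blast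
qed

text \<open>For each orbital of the tower the element one level up serves as \<open>h\<close>, so
  the orbitals stay and only the signatures are replaced by commutators.\<close>

lemma tall_derived:
  assumes G: "subgroup G PLo" and nc: "\<not> crossing G"
  shows "tall G n a b \<Longrightarrow> h \<in> G \<Longrightarrow> component {h} c d \<Longrightarrow> c \<le> a \<Longrightarrow> b \<le> d \<Longrightarrow>
    (a, b) \<noteq> (c, d) \<Longrightarrow> tall (derived PLo G) n a b"
proof (induction arbitrary: h c d rule: tall.induct)
  case (tall_base g a b)
  then show ?case
    using not_crossing_commutator_component[OF G nc] tall.tall_base by metis
next
  case (tall_step n a b g c' d')
  have "tall (derived PLo G) n a b" using tall_step.IH tall_step.hyps by blast
  moreover obtain k where "k \<in> derived PLo G" "component {k} c' d'"
    using not_crossing_commutator_component[OF G nc tall_step.hyps(2) tall_step.prems(1)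
        tall_step.hyps(3) tall_step.prems(2-5)] by blast
  ultimately show ?case using tall.tall_step tall_step.hyps(4-6) by blast
qed

text \<open>If every element of \<open>G\<close> fixed the left end of the orbital, then elements of the
  derived subgroup would be trivial near it.\<close>

lemma derived_component_enlarge:
  assumes G: "subgroup G PLo" and nc: "\<not> crossing G"
    and k: "k \<in> derived PLo G" and ck: "component {k} a b"
  obtains h c d where "h \<in> G" "component {h} c d" "c < a" "b < d"
proof -
  note GP = subgroup_PLoD(1)[OF G]
  have kG: "k \<in> G" using k derived_subset(1)[OF G] by blast
  have ab: "a < b" using ck by (simp add: component_def)
  have "\<exists>h\<in>G. h a \<noteq> a"
  proof (rule ccontr)
    assume "\<not> ?thesis"
    then have "germ_id 1 a k"
      using derived_germ_id[OF GP _ component_inner_side(1)[OF _ ck] k] kG GP by blast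
    then obtain e where e: "0 < e" "\<forall>t\<in>{0..e}. k (a + 1 * t) = a + 1 * t"
      unfolding germ_id_def by blast
    have "k (a + min e ((b - a) / 2)) = a + min e ((b - a) / 2)"
      using bspec[OF e(2), of "min e ((b - a) / 2)"] e(1) ab by simp
    moreover have "0 < min e ((b - a) / 2)" "min e ((b - a) / 2) < b - a" using e(1) ab by (auto simp: min_def field_simps)
    ultimately show False
      using component_fixed_outside[OF ck, of "a + min e ((b - a) / 2)"] by linarith
  qed
  then obtain h where h: "h \<in> G" "h a \<noteq> a" by blast
  then obtain c d where cd: "component {h} c d" "c < a" "a < d"
    using PL_component_exists[of "{h}" h a] GP by blast
  \<comment> \<open>The orbital of \<open>h\<close> contains the end \<open>a\<close>, which leaves
    strict containment of [a, b] as the only noncrossing case.\<close>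
  then show ?thesis using not_crossing_cases[OF nc kG h(1) ck cd(1)] ab that[OF h(1) cd(1)] by auto
qed

section \<open>Derived series and tower height\<close>

text \<open>With crossing orbitals all heights occur. Otherwise the top orbital, coming from the
  derived subgroup, lies strictly inside an orbital of \<open>G\<close>.\<close>

lemma tall_of_derived:
  assumes G: "subgroup G PLo" and t: "tall (derived PLo G) n a b"
  shows "\<exists>c d. tall G (Suc n) c d"
proof (cases "crossing G")
  case True
  then show ?thesis using crossing_tall[OF G] by blast
next
  case False
  obtain k where "k \<in> derived PLo G" "component {k} a b" using t by (rule tall_top)
  then obtain h c d where "h \<in> G" "component {h} c d" "c < a" "b < d"
    using derived_component_enlarge[OF G False] by metis
  then have "tall G (Suc n) c d"
    by (intro tall_step[OF tall_mono[OF t derived_subset(1)[OF G]]]) auto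
  then show ?thesis by blast
qed

text \<open>Both directions use induction over all \<open>G\<close>, replacing \<open>G\<close> by
  its derived subgroup; the base case says that a group is trivial iff no element has an orbital. A
  trivial term of the series rules out crossing, by \<open>crossing_derived_series\<close>.\<close>

lemma derived_series_trivial_iff:
  assumes G: "subgroup G PLo"
  shows "(derived PLo ^^ n) G = {id} \<longleftrightarrow> (\<nexists>a b. tall G (Suc n) a b)"
proof
  assume triv: "(derived PLo ^^ n) G = {id}"
  show "\<nexists>a b. tall G (Suc n) a b"
  proof
    assume "\<exists>a b. tall G (Suc n) a b"
    then show False using triv G
    proof (induction n arbitrary: G)
      case 0
      then have "G = {id}" by (simp only: funpow_0)
      then obtain a b where "tall {id} (Suc 0) a b" using 0(1) by blast
      then obtain g where "g \<in> {id}" "component {g} a b" by (rule tall_top)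
      then show False using component_nontrivial[of "{g}" a b] by simp
    next
      case (Suc n)
      have nc: "\<not> crossing G"
        using crossing_derived_series[OF Suc.prems(3)] Suc.prems(2) by metis
      obtain a b where "tall G (Suc (Suc n)) a b" using Suc.prems(1) by (elim exE)
      \<comment> \<open>The top orbital is given up; its signature serves as \<open>h\<close> for
        the tower below it.\<close>
      then have "\<exists>a b. tall (derived PLo G) (Suc n) a b"
      proof cases
        case (tall_step a' b' g)
        then show ?thesis using tall_derived[OF Suc.prems(3) nc] by metis
      qed
      moreover have "(derived PLo ^^ n) (derived PLo G) = {id}"
        using Suc.prems(2) by (simp only: funpow_Suc_right o_apply)
      ultimately show False using Suc.IH derived_subset(2)[OF Suc.prems(3)] by blast
    qed
  qed
next
  assume "\<nexists>a b. tall G (Suc n) a b"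
  then show "(derived PLo ^^ n) G = {id}" using G
  proof (induction n arbitrary: G)
    case 0
    note GP = subgroup_PLoD(1)[OF 0(2)]
    have "g = id" if g: "g \<in> G" for g
    proof (rule ccontr)
      assume "g \<noteq> id"
      then obtain x where "g x \<noteq> x" by (auto simp: fun_eq_iff)
      then obtain a b where "component {g} a b"
        using PL_component_exists[of "{g}" g x] g GP by blast
      then show False using 0(1) tall_base[OF g] by blast
    qed
    then have "G = {id}" using subgroup_PLoD(2)[OF 0(2)] by blast
    then show ?case by (simp only: funpow_0)
  next
    case (Suc n)
    have "\<nexists>a b. tall (derived PLo G) (Suc n) a b"
      using tall_of_derived[OF Suc.prems(2)] Suc.prems(1) by blast
    then have "(derived PLo ^^ n) (derived PLo G) = {id}"
      using Suc.IH derived_subset(2)[OF Suc.prems(2)] by blast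
    then show ?case by (simp only: funpow_Suc_right o_apply)
  qed
qed

text \<open>Commutators do not depend on the ambient group. The inclusion in \<open>G\<close> is
  carried along so that \<open>derived_consistent\<close> applies at each step.\<close>

lemma derived_series_restrict:
  assumes G: "subgroup G PLo"
  shows "(derived (PLo\<lparr>carrier := G\<rparr>) ^^ n) G = (derived PLo ^^ n) G"
proof -
  have "(derived (PLo\<lparr>carrier := G\<rparr>) ^^ n) G = (derived PLo ^^ n) G \<and> (derived PLo ^^ n) G \<subseteq> G"
  proof (induction n)
    case (Suc n)
    then show ?case
      using PLo.derived_consistent[OF _ G] PLo.derived_incl[OF _ G] by simp
  qed simp
  then show ?thesis by blast
qed

theorem theorem1p1:
  fixes G :: "(real \<Rightarrow> real) set" and n :: nat
  assumes "subgroup G PLo"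
  shows "(solvable (PLo\<lparr>carrier := G\<rparr>) \<and> derived_length (PLo\<lparr>carrier := G\<rparr>) = n)
           \<longleftrightarrow> depth G = enat n"
proof -
  interpret GG: group "PLo\<lparr>carrier := G\<rparr>"
    using assms by (rule PLo.subgroup_imp_group)
  \<comment> \<open>A threshold statement for every \<open>m\<close> yields both solvability and the
    least number in \<open>derived_length\<close>.\<close>
  have triv: "(derived (PLo\<lparr>carrier := G\<rparr>) ^^ m) G = {id} \<longleftrightarrow> depth G \<le> enat m" for m
  proof -
    have "depth G \<le> enat m \<longleftrightarrow> \<not> enat (Suc m) \<le> depth G"
      by (cases "depth G") auto
    then show ?thesis
      unfolding derived_series_restrict[OF assms] derived_series_trivial_iff[OF assms]
        depth_ge_iff_tall[OF subgroup_PLoD(1)[OF assms]] by simp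
  qed
  have "solvable (PLo\<lparr>carrier := G\<rparr>) \<longleftrightarrow> (\<exists>m. depth G \<le> enat m)"
    using GG.solvable_iff_trivial_derived_seq triv by (simp add: PLo_simps)
  moreover have "derived_length (PLo\<lparr>carrier := G\<rparr>) = (LEAST m. depth G \<le> enat m)"
    using triv by (simp add: derived_length_def PLo_simps)
  moreover have "(LEAST m. enat d \<le> enat m) = d" for d
    by (rule Least_equality) auto
  \<comment> \<open>For infinite depth the group is not solvable, so the unspecified value of
    \<open>derived_length\<close> does no harm.\<close>
  ultimately show ?thesis by (cases "depth G") auto
qed

end
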